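(* Let $0<p\le1$, let $\omega$ be an almost monotone weight on $\mathbb N^2$, and let $\widetilde a:\mathbb H^2\to\mathbb C$ have a $p$-th power $\omega$-absolutely convergent Dirichlet series. (I) If $\widetilde a$ is bounded away from zero on $\mathbb H^2$, then there is an almost monotone weight $\nu$ on $\mathbb N^2$ such that: $\nu$ is constant iff $\omega$ is constant; $\nu$ is admissible iff $\omega$ is admissible; $1\le\nu\le\omega$; and $1/\widetilde a$ has a $p$-th power $\nu$-absolutely convergent Dirichlet series. (II) If $\varphi$ is holomorphic on an open neighbourhood of the closure of the range of $\widetilde a$, then there is an almost monotone weight $\xi$ on $\mathbb N^2$ such that: $\xi$ is constant iff $\omega$ is constant; $\xi$ is admissible iff $\omega$ is admissible; $1\le\xi\le\omega$; and $\varphi\circ\widetilde a$ has a $p$-th power $\xi$-absolutely convergent Dirichlet series.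
   Context: $\mathbb H=\{\operatorname{Re}z\ge0\}$. A weight on $\mathbb N^2$ (coordinatewise multiplication) is $\omega:\mathbb N^2\to[1,\infty)$ with $\omega(xy)\le\omega(x)\omega(y)$; admissible if $\lim_n\omega(l^n,k^n)^{1/n}=1$ for all $(l,k)$; almost monotone if either it is admissible, or there is $K>0$ such that $\omega(m_1,n_1)\le K\omega(m_2,n_2)$ whenever either $m_1\mid m_2$ or $n_1\mid n_2$. For $0<p\le1$, $\widetilde a:\mathbb H^2\to\mathbb C$ has a $p$-th power $\omega$-absolutely convergent Dirichlet series if there is $a:\mathbb N^2\to\mathbb C$ with $\sum_{(m,n)}|a(m,n)|^p\omega(m,n)<\infty$ and $\widetilde a(s_1,s_2)=\sum_{(m,n)}a(m,n)m^{-s_1}n^{-s_2}$ for all $(s_1,s_2)\in\mathbb H^2$. Bounded away from zero means $|\widetilde a|\ge k$ on $\mathbb H^2$ for some $k>0$. *)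

theory Defs
  imports "HOL-Complex_Analysis.Complex_Analysis"
begin

text \<open>Positive integers \<open>\<nat> = {1,2,...}\<close>; weights are functions on pairs of naturals,
  only their values on positive pairs matter.\<close>

definition Npos :: "nat set" where "Npos = {1..}"

definition Hplane :: "complex set" where "Hplane = {z. Re z \<ge> 0}"

definition is_weight :: "(nat \<Rightarrow> nat \<Rightarrow> real) \<Rightarrow> bool" where
  "is_weight \<omega> \<longleftrightarrow>
     (\<forall>m\<in>Npos. \<forall>n\<in>Npos. 1 \<le> \<omega> m n) \<and>
     (\<forall>m1\<in>Npos. \<forall>n1\<in>Npos. \<forall>m2\<in>Npos. \<forall>n2\<in>Npos.
        \<omega> (m1 * m2) (n1 * n2) \<le> \<omega> m1 n1 * \<omega> m2 n2)"

definition admissible_weight :: "(nat \<Rightarrow> nat \<Rightarrow> real) \<Rightarrow> bool" where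
  "admissible_weight \<omega> \<longleftrightarrow>
     (\<forall>l\<in>Npos. \<forall>k\<in>Npos. (\<lambda>j. \<omega> (l ^ j) (k ^ j) powr (1 / real j)) \<longlonglongrightarrow> 1)"

definition almost_monotone_weight :: "(nat \<Rightarrow> nat \<Rightarrow> real) \<Rightarrow> bool" where
  "almost_monotone_weight \<omega> \<longleftrightarrow> is_weight \<omega> \<and>
     (admissible_weight \<omega> \<or>
      (\<exists>K>0. \<forall>m1\<in>Npos. \<forall>n1\<in>Npos. \<forall>m2\<in>Npos. \<forall>n2\<in>Npos.
         (m1 dvd m2 \<or> n1 dvd n2) \<longrightarrow> \<omega> m1 n1 \<le> K * \<omega> m2 n2))"

definition constant_weight :: "(nat \<Rightarrow> nat \<Rightarrow> real) \<Rightarrow> bool" where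
  "constant_weight \<omega> \<longleftrightarrow> (\<exists>c. \<forall>m\<in>Npos. \<forall>n\<in>Npos. \<omega> m n = c)"

definition has_p_omega_DS ::
  "real \<Rightarrow> (nat \<Rightarrow> nat \<Rightarrow> real) \<Rightarrow> (complex \<Rightarrow> complex \<Rightarrow> complex) \<Rightarrow> bool" where
  "has_p_omega_DS p \<omega> f \<longleftrightarrow>
     (\<exists>a :: nat \<Rightarrow> nat \<Rightarrow> complex.
        (\<lambda>(m, n). norm (a m n) powr p * \<omega> m n) summable_on (Npos \<times> Npos) \<and>
        (\<forall>s1\<in>Hplane. \<forall>s2\<in>Hplane.
           ((\<lambda>(m, n). a m n * of_nat m powr (- s1) * of_nat n powr (- s2))
              has_sum f s1 s2) (Npos \<times> Npos)))"

end

theory Submission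
  imports Defs
begin

text \<open>
  One may take \<open>\<nu> = \<xi> = \<omega>\<close>: an almost monotone weight is always admissible, and (I) is (II) for
  \<open>\<phi> z = 1 / z\<close>. Split the series as \<open>f = P + e\<close> with a Dirichlet polynomial \<open>P\<close> and a tail \<open>e\<close> of
  small norm, and expand \<open>\<phi> \<circ> f = (\<Sum>k. (\<phi>\<^bsup>(k)\<^esup> \<circ> P) / k! * e\<^bsup>k\<^esup>)\<close>. Each \<open>\<phi>\<^bsup>(k)\<^esup> \<circ> P / k!\<close> is holomorphic and
  bounded by \<open>M / \<delta>\<^bsup>k\<^esup>\<close> on a half-plane slightly larger than \<open>Re s \<ge> 0\<close> in each variable, because a
  polynomial changes little under a small horizontal shift. By Bohr's principle this bounds its
  Dirichlet coefficients by \<open>M / \<delta>\<^bsup>k\<^esup> * (m n)\<^bsup>-\<eta>\<^esup>\<close>. They are supported on the monoid generated by the finite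
  support of \<open>P\<close>, on which the decay beats an admissible weight, so the expansion converges in the
  weighted \<open>p\<close>-norm.
\<close>

section \<open>Weighted \<open>p\<close>-summable families\<close>

text \<open>A bound for the modulus of a function does not by itself bound the sum of its weighted
  coefficients, and for p < 1 the coefficient space is not locally convex, so a vector-valued Cauchy
  integral is not at hand. The polynomial P gets round both: its compositions stay bounded beyond
  the edge Re s = 0, and this excess turns a modulus bound into summable coefficients. The price is
  the sum C of (m n)^(-\<eta> p) \<omega>(m, n) over the monoid generated by the support of P. It
  may be enormous, since \<eta> and the monoid depend on how much of the series was put into P, but
  it enters each term of the expansion once, not to the power k. Hence the order of choice: \<delta>
  comes from U and the compact closure of the range alone, then P with a tail of norm N <
  \<delta>^p, then \<eta>. The k-th term has norm at most M^p C (N / \<delta>^p)^k, summable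
  whatever C is. That the monoid is finitely generated matters: over all pairs, (m n)^(-\<eta> p)
  has a divergent sum once \<eta> p \<le> 1.\<close>

lemma sum_powr_le:
  fixes t :: "'i \<Rightarrow> real"
  assumes p: "0 < p" "p \<le> 1" and t: "\<And>i. i \<in> F \<Longrightarrow> 0 \<le> t i"
  shows "sum t F powr p \<le> (\<Sum>i\<in>F. t i powr p)"
proof (cases "finite F \<and> sum t F \<noteq> 0")
  case False
  then show ?thesis by (auto intro!: sum_nonneg)
next
  case True
  define S where "S = sum t F"
  have S: "S > 0"
    using True sum_nonneg[of F t] t unfolding S_def by (simp add: order_less_le)
  have le: "t i / S \<le> t i powr p / S powr p" if i: "i \<in> F" for i
  proof -
    have "t i \<le> S"
      unfolding S_def using True t i by (intro member_le_sum) auto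
    \<comment> \<open>The ratios lie in [0, 1], where passing from exponent 1 to p does not decrease
      a power; since they add up to 1, the claim follows by summation.\<close>
    then have "(t i / S) powr 1 \<le> (t i / S) powr p"
      using p S t[OF i] by (intro powr_mono') (auto simp: divide_simps)
    then show ?thesis
      using S t[OF i] by (simp add: powr_divide)
  qed
  have "1 = (\<Sum>i\<in>F. t i / S)"
    using S by (simp add: S_def flip: sum_divide_distrib)
  also have "\<dots> \<le> (\<Sum>i\<in>F. t i powr p / S powr p)"
    by (intro sum_mono le)
  also have "\<dots> = (\<Sum>i\<in>F. t i powr p) / S powr p"
    by (simp add: sum_divide_distrib)
  finally show ?thesis
    using S by (simp add: S_def divide_simps)
qed

text \<open>Subadditivity of the p-th power bounds all finite sums by \<open>N powr (1/p)\<close>,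
  so the inequality survives the passage to infinite sums. It plays the part of the triangle
  inequality for the weighted p-sums.\<close>

lemma summable_on_of_powr:
  fixes t :: "'i \<Rightarrow> real"
  assumes p: "0 < p" "p \<le> 1" and t: "\<And>i. i \<in> A \<Longrightarrow> 0 \<le> t i"
    and sm: "(\<lambda>i. t i powr p) summable_on A"
  shows "t summable_on A" and "infsum t A powr p \<le> (\<Sum>\<^sub>\<infinity>i\<in>A. t i powr p)"
proof -
  define N where "N = (\<Sum>\<^sub>\<infinity>i\<in>A. t i powr p)"
  have N0: "0 \<le> N" unfolding N_def by (intro infsum_nonneg) auto
  have fin: "sum t F \<le> N powr (1/p)" if F: "finite F" "F \<subseteq> A" for F
  proof -
    have "sum t F powr p \<le> (\<Sum>i\<in>F. t i powr p)"
      using p t F by (intro sum_powr_le) auto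
    also have "\<dots> \<le> N"
      unfolding N_def using sm F by (intro finite_sum_le_infsum) auto
    finally have "(sum t F powr p) powr (1/p) \<le> N powr (1/p)"
      using p by (intro powr_mono2) auto
    moreover have "0 \<le> sum t F" using t F by (intro sum_nonneg) auto
    ultimately show ?thesis using p by (simp add: powr_powr)
  qed
  show s: "t summable_on A"
    using t fin by (intro nonneg_bdd_above_summable_on) (auto simp: bdd_above_def)
  have "infsum t A \<le> N powr (1/p)"
    using fin by (intro infsum_le_finite_sums s) auto
  then have "infsum t A powr p \<le> (N powr (1/p)) powr p"
    using p t by (intro powr_mono2) (auto intro: infsum_nonneg)
  then show "infsum t A powr p \<le> (\<Sum>\<^sub>\<infinity>i\<in>A. t i powr p)"
    using p N0 by (simp add: powr_powr N_def)
qed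

text \<open>An expansion indexed by an arbitrary family \<open>J\<close>, with repetitions among the points
  \<open>P j\<close>, suffices: this makes products of series trivial, since no convolution is needed.\<close>

lemma regroup_coefficients:
  fixes C :: "'j \<Rightarrow> complex" and P :: "'j \<Rightarrow> 'x" and w :: "'x \<Rightarrow> real"
  assumes p: "0 < p" "p \<le> 1" and P: "\<And>j. j \<in> J \<Longrightarrow> P j \<in> T"
    and w: "\<And>x. x \<in> T \<Longrightarrow> 0 < w x"
    and sm: "(\<lambda>j. norm (C j) powr p * w (P j)) summable_on J"
  shows "\<exists>v. (\<lambda>x. norm (v x) powr p * w x) summable_on T \<and>
    (\<forall>\<theta> R. ((\<lambda>j. C j * \<theta> (P j)) has_sum R) J \<longrightarrow> ((\<lambda>x. v x * \<theta> x) has_sum R) T)"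
proof -
  define B where "B x = {j \<in> J. P j = x}" for x
  define v where "v x = infsum C (B x)" for x
  \<comment> \<open>\<open>J\<close> is the disjoint union of the fibres \<open>B x\<close>, so sums
    over \<open>J\<close> can be taken fibre by fibre.\<close>
  have bij: "bij_betw snd (Sigma T B) J"
    by (rule bij_betw_byWitness[where f' = "\<lambda>j. (P j, j)"]) (auto simp: B_def P)
  have sm2: "(\<lambda>(x, j). norm (C j) powr p * w x) summable_on Sigma T B"
  proof -
    have "(\<lambda>z. norm (C (snd z)) powr p * w (P (snd z))) summable_on Sigma T B"
      using summable_on_reindex_bij_betw[OF bij, of "\<lambda>j. norm (C j) powr p * w (P j)"] sm by simp
    then show ?thesis
      by (rule summable_on_cong[THEN iffD1, rotated]) (auto simp: B_def)
  qed
  have fib: "(\<lambda>j. norm (C j) powr p * w x) summable_on B x" if "x \<in> T" for x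
    using summable_on_SigmaD1[OF sm2 that] .
  have fib1: "(\<lambda>j. norm (C j) powr p) summable_on B x" if x: "x \<in> T" for x
    using fib[OF x] w[OF x] by (simp add: summable_on_cmult_left')
  have fib2: "(\<lambda>j. norm (C j)) summable_on B x" if x: "x \<in> T" for x
    by (rule summable_on_of_powr(1)[OF p _ fib1[OF x]]) auto
  \<comment> \<open>Merging repetitions does not increase the weighted p-sum: on one fibre the
    weight is constant and p-subadditivity applies.\<close>
  have v_le: "norm (v x) powr p * w x \<le> (\<Sum>\<^sub>\<infinity>j\<in>B x. norm (C j) powr p * w x)" if x: "x \<in> T" for x
  proof -
    have "norm (v x) powr p \<le> (\<Sum>\<^sub>\<infinity>j\<in>B x. norm (C j)) powr p"
      unfolding v_def using p by (intro powr_mono2 norm_infsum_bound fib2 x) auto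
    also have "\<dots> \<le> (\<Sum>\<^sub>\<infinity>j\<in>B x. norm (C j) powr p)"
      by (rule summable_on_of_powr(2)[OF p _ fib1[OF x]]) auto
    finally show ?thesis
      using w[OF x] by (simp add: infsum_cmult_left')
  qed
  show ?thesis
  proof (intro exI conjI allI impI)
    have "(\<lambda>x. \<Sum>\<^sub>\<infinity>j\<in>B x. norm (C j) powr p * w x) summable_on T"
      using summable_on_SigmaD[OF sm2] fib by auto
    then show "(\<lambda>x. norm (v x) powr p * w x) summable_on T"
      by (rule summable_on_comparison_test) (simp_all add: v_le w less_imp_le)
  next
    fix \<theta> :: "'x \<Rightarrow> complex" and R
    assume "((\<lambda>j. C j * \<theta> (P j)) has_sum R) J"
    then have "((\<lambda>z. C (snd z) * \<theta> (P (snd z))) has_sum R) (Sigma T B)"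
      using has_sum_reindex_bij_betw[OF bij, of "\<lambda>j. C j * \<theta> (P j)"] by simp
    then have "((\<lambda>(x, j). C j * \<theta> x) has_sum R) (Sigma T B)"
      by (rule has_sum_cong[THEN iffD1, rotated]) (auto simp: B_def)
    then show "((\<lambda>x. v x * \<theta> x) has_sum R) T"
      by (rule has_sum_SigmaD)
        (auto simp: v_def intro!: has_sum_cmult_left has_sum_infsum abs_summable_summable fib2)
  qed
qed

section \<open>Products and powers of series, expanded over words\<close>

lemma has_sum_times:
  fixes f :: "'a \<Rightarrow> 'c::real_normed_field"
  assumes "(f has_sum a) A" "(g has_sum b) B" "(\<lambda>(x, y). f x * g y) summable_on A \<times> B"
  shows "((\<lambda>(x, y). f x * g y) has_sum a * b) (A \<times> B)"
  by (rule has_sum_SigmaI[where g = "\<lambda>x. f x * b"])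
    (use assms in \<open>auto intro!: has_sum_cmult_left has_sum_cmult_right\<close>)

lemma summable_on_times_nonneg:
  fixes f :: "'a \<Rightarrow> real"
  assumes "f summable_on A" "g summable_on B"
    and "\<And>x. x \<in> A \<Longrightarrow> 0 \<le> f x" "\<And>y. y \<in> B \<Longrightarrow> 0 \<le> g y"
  shows "(\<lambda>(x, y). f x * g y) summable_on A \<times> B"
  by (rule summable_on_SigmaI[where g = "\<lambda>x. f x * infsum g B"])
    (use assms in \<open>auto intro!: has_sum_cmult_right summable_on_cmult_left\<close>)

text \<open>Words of length k index the terms of the k-th power of a series. No multinomial
  coefficients arise; equal products are merged only at the end, by
  \<open>regroup_coefficients\<close>.\<close>

definition lists_len :: "'a set \<Rightarrow> nat \<Rightarrow> 'a list set" where
  "lists_len S k = {xs \<in> lists S. length xs = k}"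

lemma lists_len_0 [simp]: "lists_len S 0 = {[]}"
  by (auto simp: lists_len_def)

lemma bij_betw_lists_len_Suc:
  "bij_betw (\<lambda>(x, xs). x # xs) (S \<times> lists_len S k) (lists_len S (Suc k))"
  by (rule bij_betw_byWitness[where f' = "\<lambda>ys. (hd ys, tl ys)"])
    (auto simp: lists_len_def length_Suc_conv)

lemma has_sum_lists_len_nonneg:
  fixes e :: "'a \<Rightarrow> real"
  assumes "(e has_sum N) S" "\<And>x. x \<in> S \<Longrightarrow> 0 \<le> e x"
  shows "((\<lambda>xs. prod_list (map e xs)) has_sum N ^ k) (lists_len S k)"
proof (induction k)
  case 0
  then show ?case using has_sum_finite[of "{[]}" "\<lambda>xs. prod_list (map e xs)"] by simp
next
  case (Suc k)
  have nn: "0 \<le> prod_list (map e xs)" if "xs \<in> lists_len S k" for xs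
    using that assms(2) by (auto simp: lists_len_def intro!: prod_list_nonneg)
  have "((\<lambda>(x, xs). e x * prod_list (map e xs)) has_sum N * N ^ k) (S \<times> lists_len S k)"
    using assms Suc nn
    by (intro has_sum_times summable_on_times_nonneg) (auto simp: summable_on_def)
  then show ?case
    using has_sum_reindex_bij_betw[OF bij_betw_lists_len_Suc, of "\<lambda>ys. prod_list (map e ys)"]
    by (simp add: case_prod_unfold)
qed

lemma norm_prod_list_map:
  "norm (prod_list (map e xs)) = prod_list (map (\<lambda>x. norm (e x :: complex)) xs)"
  by (induction xs) (auto simp: norm_mult)

text \<open>The product step needs summability over pairs, which comes from the nonnegative version
  applied to the norms.\<close>

lemma has_sum_lists_len:
  fixes e :: "'a \<Rightarrow> complex"
  assumes "(e has_sum N) S" "(\<lambda>x. norm (e x)) summable_on S"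
  shows "((\<lambda>xs. prod_list (map e xs)) has_sum N ^ k) (lists_len S k)"
proof -
  have abs: "(\<lambda>xs. norm (prod_list (map e xs))) summable_on lists_len S k" for k
    using has_sum_lists_len_nonneg[OF has_sum_infsum[OF assms(2)], of k]
    by (auto simp: norm_prod_list_map summable_on_def)
  show "((\<lambda>xs. prod_list (map e xs)) has_sum N ^ k) (lists_len S k)"
  proof (induction k)
    case 0
    then show ?case using has_sum_finite[of "{[]}" "\<lambda>xs. prod_list (map e xs)"] by simp
  next
    case (Suc k)
    have "(\<lambda>z. norm (case z of (x, xs) \<Rightarrow> e x * prod_list (map e xs))) summable_on S \<times> lists_len S k"
      using summable_on_times_nonneg[OF assms(2) abs[of k]]
      by (simp add: case_prod_unfold norm_mult)
    then have "((\<lambda>(x, xs). e x * prod_list (map e xs)) has_sum N * N ^ k) (S \<times> lists_len S k)"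
      by (rule has_sum_times[OF assms(1) Suc abs_summable_summable])
    then show ?case
      using has_sum_reindex_bij_betw[OF bij_betw_lists_len_Suc, of "\<lambda>ys. prod_list (map e ys)"]
      by (simp add: case_prod_unfold)
  qed
qed

text \<open>Since \<open>w\<close> is submultiplicative, words of length k contribute at most
  \<open>N ^ k\<close> to the weighted p-sum, so \<open>conv\<close> bounds the whole expansion. The
  character \<theta> is quantified after \<open>v\<close> because one family of coefficients must
  serve at every point of evaluation. The statement is abstract in \<open>T\<close>,
  \<open>w\<close> and p because it is applied twice: with p = 1 to a polynomial far to the right,
  and with the given p and weight to the full series.\<close>

lemma series_of_powers_expansion:
  fixes B :: "nat \<Rightarrow> 'x \<Rightarrow> complex" and e :: "'x \<Rightarrow> complex" and w :: "'x \<Rightarrow> real"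
    and mul :: "'x \<Rightarrow> 'x \<Rightarrow> 'x"
  assumes p: "0 < p" "p \<le> 1"
    and mul: "\<And>x y. x \<in> T \<Longrightarrow> y \<in> T \<Longrightarrow> mul x y \<in> T"
    and w: "\<And>x. x \<in> T \<Longrightarrow> 0 < w x"
    and w_mul: "\<And>x y. x \<in> T \<Longrightarrow> y \<in> T \<Longrightarrow> w (mul x y) \<le> w x * w y"
    and S: "S \<subseteq> T"
    and e: "((\<lambda>x. norm (e x) powr p * w x) has_sum N) S"
    and B: "\<And>k. (\<lambda>y. norm (B k y) powr p * w y) summable_on T"
    and conv: "summable (\<lambda>k. (\<Sum>\<^sub>\<infinity>y\<in>T. norm (B k y) powr p * w y) * N ^ k)"
  shows "\<exists>v. (\<lambda>x. norm (v x) powr p * w x) summable_on T \<and>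
    (\<forall>\<theta> H Z R. (\<forall>x\<in>T. norm (\<theta> x) powr p \<le> w x) \<longrightarrow>
       (\<forall>x\<in>T. \<forall>y\<in>T. \<theta> (mul x y) = \<theta> x * \<theta> y) \<longrightarrow>
       (\<forall>k. ((\<lambda>y. B k y * \<theta> y) has_sum H k) T) \<longrightarrow>
       ((\<lambda>x. e x * \<theta> x) has_sum Z) S \<longrightarrow> (\<lambda>k. H k * Z ^ k) sums R \<longrightarrow>
       ((\<lambda>x. v x * \<theta> x) has_sum R) T)"
proof -
  \<comment> \<open>A triple \<open>(k, y, xs)\<close> stands for one term of the formal expansion:
    the term of \<open>B k\<close> at \<open>y\<close> times a word of k terms of
    \<open>e\<close>.\<close>
  define J where "J = (SIGMA k:UNIV. T \<times> lists_len S k)"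
  define C where "C = (\<lambda>(k, y, xs). B k y * prod_list (map e xs))"
  define P where "P = (\<lambda>(k::nat, y, xs). foldr mul xs y)"
  define u where "u = (\<lambda>x. norm (e x) powr p * w x)"
  have S_T: "x \<in> T" if "x \<in> S" for x using S that by auto
  have P_T: "foldr mul xs y \<in> T" if "xs \<in> lists S" "y \<in> T" for xs y
    using that by (induction xs) (simp_all add: mul S_T)
  have w_P: "w (foldr mul xs y) \<le> w y * prod_list (map w xs)" if "xs \<in> lists S" "y \<in> T" for xs y
    using that
  proof (induction xs)
    case (Cons x xs)
    then have xT: "x \<in> T" and fT: "foldr mul xs y \<in> T" by (simp_all add: S_T P_T)
    have "w (foldr mul (x # xs) y) \<le> w x * w (foldr mul xs y)"
      using w_mul[OF xT fT] by simp
    also have "\<dots> \<le> w x * (w y * prod_list (map w xs))"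
      using Cons w[OF xT] by (intro mult_left_mono) auto
    finally show ?case by (simp add: mult_ac)
  qed auto
  have powr_u: "norm (prod_list (map e xs)) powr p * prod_list (map w xs) = prod_list (map u xs)"
    if "xs \<in> lists S" for xs
    using that by (induction xs) (auto simp: u_def norm_mult powr_mult)
  have u0: "0 \<le> u x" if "x \<in> S" for x
    using w[OF S_T[OF that]] by (simp add: u_def)
  have w0: "0 \<le> norm (B k y) powr p * w y" if "y \<in> T" for k y
    using w[OF that] by simp
  have N0: "0 \<le> N" using e u0 by (auto intro: has_sum_nonneg simp: u_def)
  have sm_bound: "(\<lambda>(k, y, xs). (norm (B k y) powr p * w y) * prod_list (map u xs)) summable_on J"
    unfolding J_def
  proof (rule summable_on_SigmaI[where g = "\<lambda>k. (\<Sum>\<^sub>\<infinity>y\<in>T. norm (B k y) powr p * w y) * N ^ k"])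
    fix k :: nat
    have up: "((\<lambda>xs. prod_list (map u xs)) has_sum N ^ k) (lists_len S k)"
      using e u0 by (intro has_sum_lists_len_nonneg) (auto simp: u_def)
    have un: "0 \<le> prod_list (map u xs)" if "xs \<in> lists_len S k" for xs
      using that u0 by (auto simp: lists_len_def intro!: prod_list_nonneg)
    show "((\<lambda>z. case (k, z) of (k, y, xs) \<Rightarrow> (norm (B k y) powr p * w y) * prod_list (map u xs))
      has_sum (\<Sum>\<^sub>\<infinity>y\<in>T. norm (B k y) powr p * w y) * N ^ k) (T \<times> lists_len S k)"
      using has_sum_times[OF has_sum_infsum[OF B[of k]] up]
        summable_on_times_nonneg[OF B[of k] has_sum_imp_summable[OF up] w0 un]
      by simp
  next
    show "(\<lambda>k. (\<Sum>\<^sub>\<infinity>y\<in>T. norm (B k y) powr p * w y) * N ^ k) summable_on UNIV"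
      using conv N0 w0
      by (subst summable_on_UNIV_nonneg_real_iff) (auto intro!: mult_nonneg_nonneg infsum_nonneg less_imp_le[OF w])
  next
    fix k z assume "z \<in> T \<times> lists_len S k"
    then show "0 \<le> (case (k, z) of (k, y, xs) \<Rightarrow> (norm (B k y) powr p * w y) * prod_list (map u xs))"
      using u0 by (auto simp: lists_len_def intro!: mult_nonneg_nonneg prod_list_nonneg less_imp_le[OF w])
  qed
  have sm: "(\<lambda>j. norm (C j) powr p * w (P j)) summable_on J"
  proof (rule summable_on_comparison_test[OF sm_bound])
    fix j assume "j \<in> J"
    then obtain k y xs where j: "j = (k, y, xs)" "y \<in> T" "xs \<in> lists S"
      by (auto simp: J_def lists_len_def)
    show "0 \<le> norm (C j) powr p * w (P j)"
      using w[OF P_T[OF j(3,2)]] by (simp add: j P_def)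
    have "norm (C j) powr p * w (P j)
        \<le> norm (C j) powr p * (w y * prod_list (map w xs))"
      using w_P[OF j(3,2)] by (intro mult_left_mono) (auto simp: j P_def)
    also have "\<dots> = (norm (B k y) powr p * w y) * prod_list (map u xs)"
      by (simp add: j C_def norm_mult powr_mult powr_u[OF j(3), symmetric])
    finally show "norm (C j) powr p * w (P j)
        \<le> (case j of (k, y, xs) \<Rightarrow> (norm (B k y) powr p * w y) * prod_list (map u xs))"
      by (simp add: j)
  qed
  have PJ: "P j \<in> T" if "j \<in> J" for j
    using that P_T by (auto simp: J_def P_def lists_len_def)
  obtain v where v: "(\<lambda>x. norm (v x) powr p * w x) summable_on T"
    "\<And>\<theta> R. ((\<lambda>j. C j * \<theta> (P j)) has_sum R) J \<Longrightarrow> ((\<lambda>x. v x * \<theta> x) has_sum R) T"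
    using regroup_coefficients[OF p PJ w sm] by blast
  show ?thesis
  proof (intro exI[of _ v] conjI allI impI v(1))
    fix \<theta> :: "'x \<Rightarrow> complex" and H Z R
    assume \<theta>: "\<forall>x\<in>T. norm (\<theta> x) powr p \<le> w x"
      and \<theta>_mul: "\<forall>x\<in>T. \<forall>y\<in>T. \<theta> (mul x y) = \<theta> x * \<theta> y"
      and H: "\<forall>k. ((\<lambda>y. B k y * \<theta> y) has_sum H k) T"
      and Z: "((\<lambda>x. e x * \<theta> x) has_sum Z) S" and R: "(\<lambda>k. H k * Z ^ k) sums R"
    have abs: "(\<lambda>j. norm (C j * \<theta> (P j))) summable_on J"
    proof (rule summable_on_of_powr(1)[OF p])
      show "(\<lambda>j. norm (C j * \<theta> (P j)) powr p) summable_on J"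
        by (rule summable_on_comparison_test[OF sm])
          (simp_all add: norm_mult powr_mult mult_left_mono \<theta> PJ)
    qed auto
    have eabs: "(\<lambda>x. norm (e x * \<theta> x)) summable_on S"
    proof (rule summable_on_of_powr(1)[OF p])
      show "(\<lambda>x. norm (e x * \<theta> x) powr p) summable_on S"
        by (rule summable_on_comparison_test[OF has_sum_imp_summable[OF e]])
          (simp_all add: norm_mult powr_mult mult_left_mono \<theta> S_T)
    qed auto
    have C_\<theta>: "C (k, y, xs) * \<theta> (P (k, y, xs)) = (B k y * \<theta> y) * prod_list (map (\<lambda>x. e x * \<theta> x) xs)"
      if "y \<in> T" "xs \<in> lists S" for k y xs
    proof -
      have "\<theta> (foldr mul xs y) = \<theta> y * prod_list (map \<theta> xs)"
        using that(2) by (induction xs) (simp_all add: \<theta>_mul P_T S_T that(1))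
      moreover have "prod_list (map (\<lambda>x. e x * \<theta> x) xs) = prod_list (map e xs) * prod_list (map \<theta> xs)"
        by (induction xs) auto
      ultimately show ?thesis by (simp add: C_def P_def)
    qed
    \<comment> \<open>The unordered sum exists by absolute summability; summing it in blocks of
      constant k identifies its value with \<open>R\<close>.\<close>
    obtain R' where R': "((\<lambda>j. C j * \<theta> (P j)) has_sum R') J"
      using abs_summable_summable[OF abs] by (auto simp: summable_on_def)
    have "((\<lambda>k. H k * Z ^ k) has_sum R') UNIV"
    proof (rule has_sum_SigmaD[OF R'[unfolded J_def]])
      fix k :: nat
      have sub: "(\<lambda>z. C (k, z) * \<theta> (P (k, z))) summable_on T \<times> lists_len S k"
        using summable_on_SigmaD1[of "\<lambda>k z. C (k, z) * \<theta> (P (k, z))" UNIV "\<lambda>k. T \<times> lists_len S k"]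
          has_sum_imp_summable[OF R'] by (simp add: J_def case_prod_unfold)
      have "((\<lambda>(y, xs). (B k y * \<theta> y) * prod_list (map (\<lambda>x. e x * \<theta> x) xs)) has_sum H k * Z ^ k)
          (T \<times> lists_len S k)"
      proof (rule has_sum_times[OF H[rule_format] has_sum_lists_len[OF Z eabs]])
        show "(\<lambda>(y, xs). (B k y * \<theta> y) * prod_list (map (\<lambda>x. e x * \<theta> x) xs))
            summable_on T \<times> lists_len S k"
          by (rule summable_on_cong[THEN iffD1, OF _ sub]) (auto simp: lists_len_def intro!: C_\<theta>)
      qed
      then show "((\<lambda>z. C (k, z) * \<theta> (P (k, z))) has_sum H k * Z ^ k) (T \<times> lists_len S k)"
        by (rule has_sum_cong[THEN iffD1, rotated]) (auto simp: lists_len_def intro!: C_\<theta>[symmetric])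
    qed
    then have "R' = R" by (rule sums_unique2[OF has_sum_imp_sums R])
    then show "((\<lambda>x. v x * \<theta> x) has_sum R) T" using v(2) R' by simp
  qed
qed

section \<open>Dirichlet characters and coefficient bounds\<close>

abbreviation Npairs :: "(nat \<times> nat) set" where
  "Npairs \<equiv> Npos \<times> Npos"

definition pmul :: "nat \<times> nat \<Rightarrow> nat \<times> nat \<Rightarrow> nat \<times> nat" where
  "pmul x y = (fst x * fst y, snd x * snd y)"

definition dchar :: "complex \<Rightarrow> complex \<Rightarrow> nat \<times> nat \<Rightarrow> complex" where
  "dchar s1 s2 x = of_nat (fst x) powr (- s1) * of_nat (snd x) powr (- s2)"

text \<open>On \<open>Npairs\<close>, \<open>size_pair x powr (- A)\<close> is \<open>dchar\<close>
  at the real point \<open>(A, A)\<close>; it is the multiplicative scale against which coefficients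
  are measured.\<close>

definition size_pair :: "nat \<times> nat \<Rightarrow> real" where
  "size_pair x = real (fst x) * real (snd x)"

lemma pmul_in_Npairs: "x \<in> Npairs \<Longrightarrow> y \<in> Npairs \<Longrightarrow> pmul x y \<in> Npairs"
  by (cases x; cases y) (auto simp: pmul_def Npos_def Suc_le_eq)

lemma Npairs_pos: "x \<in> Npairs \<Longrightarrow> 0 < fst x" "x \<in> Npairs \<Longrightarrow> 0 < snd x"
  by (auto simp: Npos_def)

lemma size_pair_ge_1: "x \<in> Npairs \<Longrightarrow> 1 \<le> size_pair x"
  using mult_mono[of 1 "real (fst x)" 1 "real (snd x)"] Npairs_pos[of x]
  by (simp add: size_pair_def Suc_le_eq)

lemma size_pair_mult: "size_pair (pmul x y) = size_pair x * size_pair y"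
  by (simp add: size_pair_def pmul_def)

lemma dchar_exp:
  assumes "x \<in> Npairs"
  shows "dchar s1 s2 x = exp (- (s1 * of_real (ln (real (fst x))) + s2 * of_real (ln (real (snd x)))))"
  using Npairs_pos[OF assms] by (simp add: dchar_def powr_def exp_diff exp_minus field_simps)

lemma dchar_mult:
  assumes "x \<in> Npairs" "y \<in> Npairs"
  shows "dchar s1 s2 (pmul x y) = dchar s1 s2 x * dchar s1 s2 y"
proof -
  note pos = Npairs_pos[OF assms(1)] Npairs_pos[OF assms(2)]
  show ?thesis
    using pos
    by (simp add: dchar_exp assms pmul_in_Npairs flip: exp_add)
      (simp add: pmul_def ln_mult algebra_simps)
qed

lemma size_pair_powr:
  assumes "x \<in> Npairs"
  shows "size_pair x powr r = exp (r * (ln (real (fst x)) + ln (real (snd x))))"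
  using Npairs_pos[OF assms] by (simp add: size_pair_def powr_def ln_mult)

lemma norm_dchar_le:
  assumes "x \<in> Npairs" "A \<le> Re s1" "A \<le> Re s2"
  shows "norm (dchar s1 s2 x) \<le> size_pair x powr (- A)"
proof -
  have "0 \<le> ln (real (fst x))" "0 \<le> ln (real (snd x))"
    using Npairs_pos[OF assms(1)] by (auto simp: Suc_le_eq)
  then have "A * ln (real (fst x)) \<le> Re s1 * ln (real (fst x))"
    "A * ln (real (snd x)) \<le> Re s2 * ln (real (snd x))"
    using assms by (auto intro!: mult_right_mono)
  then show ?thesis
    using assms(1) by (simp add: dchar_exp size_pair_powr algebra_simps)
qed

section \<open>Isolating one coefficient by averaging\<close>

lemma real_avoid_countable:
  assumes "countable (C :: real set)"
  obtains \<tau> where "\<tau> \<notin> C"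
  using assms uncountable_UNIV_real by (metis UNIV_eq_I)

text \<open>Each \<open>y\<close> and \<open>k\<close> forbid one line in the plane of
  \<open>(\<tau>1, \<tau>2)\<close>, and there are countably many. The choice of \<tau>1 settles the
  \<open>y\<close> that share the second coordinate of \<open>x\<close>; for this \<tau>1, each
  remaining line excludes a single \<tau>2.\<close>

lemma generic_shift:
  assumes "x \<in> Npairs"
  obtains \<tau>1 \<tau>2 :: real where "\<And>y k. y \<in> Npairs \<Longrightarrow> y \<noteq> x \<Longrightarrow>
    \<tau>1 * (ln (real (fst x)) - ln (real (fst y))) + \<tau>2 * (ln (real (snd x)) - ln (real (snd y)))
      \<noteq> 2 * of_int k * pi"
proof -
  define d1 where "d1 m = ln (real (fst x)) - ln (real m)" for m
  define d2 where "d2 m = ln (real (snd x)) - ln (real m)" for m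
  \<comment> \<open>Where \<open>d1 m = 0\<close> the quotient is 0 and merely excludes one further
    number; the same holds for \<open>d2 n\<close> in the choice of \<tau>2.\<close>
  obtain \<tau>1 where t1: "\<tau>1 \<notin> range (\<lambda>(m, k::int). 2 * of_int k * pi / d1 m)"
    by (rule real_avoid_countable[of "range (\<lambda>(m, k::int). 2 * of_int k * pi / d1 m)"]) auto
  obtain \<tau>2 where t2: "\<tau>2 \<notin> range (\<lambda>(m, n, k::int). (2 * of_int k * pi - \<tau>1 * d1 m) / d2 n)"
    by (rule real_avoid_countable
        [of "range (\<lambda>(m, n, k::int). (2 * of_int k * pi - \<tau>1 * d1 m) / d2 n)"]) auto
  show ?thesis
  proof
    fix y :: "nat \<times> nat" and k :: int assume y: "y \<in> Npairs" "y \<noteq> x"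
    show "\<tau>1 * (ln (real (fst x)) - ln (real (fst y))) + \<tau>2 * (ln (real (snd x)) - ln (real (snd y)))
      \<noteq> 2 * of_int k * pi"
    proof
      assume eq: "\<tau>1 * (ln (real (fst x)) - ln (real (fst y)))
        + \<tau>2 * (ln (real (snd x)) - ln (real (snd y))) = 2 * of_int k * pi"
      show False
      proof (cases "snd y = snd x")
        case True
        then have "fst y \<noteq> fst x" using y by (auto simp: prod_eq_iff)
        then have "d1 (fst y) \<noteq> 0"
          using Npairs_pos[OF assms] Npairs_pos[OF y(1)] by (simp add: d1_def)
        then have "\<tau>1 = 2 * of_int k * pi / d1 (fst y)"
          using eq True by (simp add: d1_def field_simps)
        then show False
          using t1 rangeI[of "\<lambda>(m, k::int). 2 * of_int k * pi / d1 m" "(fst y, k)"] by simp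
      next
        case False
        then have "d2 (snd y) \<noteq> 0"
          using Npairs_pos[OF assms] Npairs_pos[OF y(1)] by (simp add: d2_def)
        then have "\<tau>2 = (2 * of_int k * pi - \<tau>1 * d1 (fst y)) / d2 (snd y)"
          using eq by (simp add: d1_def d2_def field_simps)
        then show False
          using t2 rangeI[of "\<lambda>(m, n, k::int). (2 * of_int k * pi - \<tau>1 * d1 m) / d2 n" "(fst y, snd y, k)"]
          by simp
      qed
    qed
  qed
qed

lemma geometric_averages_tendsto_0:
  fixes z :: complex
  assumes "norm z = 1" "z \<noteq> 1"
  shows "(\<lambda>K. (\<Sum>j<Suc K. z ^ j) / of_nat (Suc K)) \<longlonglongrightarrow> 0"
proof (rule Lim_null_comparison)
  show "\<forall>\<^sub>F K in sequentially. norm ((\<Sum>j<Suc K. z ^ j) / of_nat (Suc K))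
      \<le> (2 / norm (z - 1)) * inverse (real (Suc K))"
  proof (intro always_eventually allI)
    fix K
    have "norm (z ^ Suc K - 1) \<le> 2"
      using norm_triangle_ineq4[of "z ^ Suc K" 1] assms(1) by (simp add: norm_power norm_mult)
    then have "norm (\<Sum>j<Suc K. z ^ j) \<le> 2 / norm (z - 1)"
      using assms(2) by (simp only: geometric_sum[OF assms(2)] norm_divide) (simp add: divide_right_mono)
    then show "norm ((\<Sum>j<Suc K. z ^ j) / of_nat (Suc K))
      \<le> (2 / norm (z - 1)) * inverse (real (Suc K))"
      by (simp only: norm_divide norm_of_nat divide_inverse[of _ "real (Suc K)"] mult_right_mono
          inverse_nonnegative_iff_nonnegative of_nat_0_le_iff)
  qed
  show "(\<lambda>K. (2 / norm (z - 1)) * inverse (real (Suc K))) \<longlonglongrightarrow> 0"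
    using tendsto_mult_left[OF LIMSEQ_inverse_real_of_nat, of "2 / norm (z - 1)"] by simp
qed

lemma has_sum_sum:
  fixes f :: "'i \<Rightarrow> 'a \<Rightarrow> 'b::topological_comm_monoid_add"
  assumes "\<And>i. i \<in> I \<Longrightarrow> (f i has_sum s i) T"
  shows "((\<lambda>y. \<Sum>i\<in>I. f i y) has_sum (\<Sum>i\<in>I. s i)) T"
  using assms by (induction I rule: infinite_finite_induct) (auto intro!: has_sum_add has_sum_0)

text \<open>Dominated convergence for unordered sums: the majorant \<open>norm (B y)\<close> makes
  the finite partial sums converge uniformly in \<open>K\<close>, so the two limits may be
  interchanged.\<close>

lemma tendsto_has_sum_dominated:
  fixes B :: "'a \<Rightarrow> complex" and c :: "nat \<Rightarrow> 'a \<Rightarrow> complex"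
  assumes B: "(\<lambda>y. norm (B y)) summable_on T"
    and c_le: "\<And>K y. y \<in> T \<Longrightarrow> norm (c K y) \<le> 1"
    and c_lim: "\<And>y. y \<in> T \<Longrightarrow> (\<lambda>K. c K y) \<longlonglongrightarrow> d y"
    and F: "\<And>K. ((\<lambda>y. B y * c K y) has_sum F K) T"
    and L: "((\<lambda>y. B y * d y) has_sum L) T"
  shows "F \<longlonglongrightarrow> L"
proof (rule swap_uniform_limit')
  show "uniform_limit UNIV (\<lambda>Y K. \<Sum>y\<in>Y. B y * c K y) F (finite_subsets_at_top T)"
  proof (rule Weierstrass_m_test_general')
    show "norm (B y * c K y) \<le> norm (B y)" if "y \<in> T" for y K
      using mult_left_mono[OF c_le[OF that], of "norm (B y)" K] by (simp add: norm_mult)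
  qed (use B F in auto)
  show "\<forall>\<^sub>F Y in finite_subsets_at_top T. (\<lambda>K. \<Sum>y\<in>Y. B y * c K y) \<longlonglongrightarrow> (\<Sum>y\<in>Y. B y * d y)"
    by (rule eventually_finite_subsets_at_top_weakI) (auto intro!: tendsto_sum tendsto_mult_left c_lim)
  show "((\<lambda>Y. \<Sum>y\<in>Y. B y * d y) \<longlongrightarrow> L) (finite_subsets_at_top T)"
    using L by (simp add: has_sum_def)
qed auto

text \<open>Averaging \<open>G\<close> along a generic vertical progression isolates one coefficient where the
  series converges; by Montel's theorem and analytic continuation the averages have the same limit
  wherever \<open>G\<close> is bounded, so the coefficient inherits the bound up to the edge.\<close>

lemma dirichlet_coefficient_bound:
  fixes b :: "nat \<times> nat \<Rightarrow> complex"
  assumes T: "T \<subseteq> Npairs"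
    and sm: "(\<lambda>x. norm (b x) * size_pair x powr (- A)) summable_on T"
    and DS: "\<And>s1 s2. A \<le> Re s1 \<Longrightarrow> A \<le> Re s2 \<Longrightarrow> ((\<lambda>x. b x * dchar s1 s2 x) has_sum G s1 s2) T"
    and bd: "\<And>s1 s2. - \<eta> < Re s1 \<Longrightarrow> - \<eta> < Re s2 \<Longrightarrow> norm (G s1 s2) \<le> M"
    and hol: "\<And>c1 c2. Re c1 = 0 \<Longrightarrow> Re c2 = 0 \<Longrightarrow>
        (\<lambda>t. G (t + c1) (t + c2)) holomorphic_on {t. - \<eta> < Re t}"
    and x: "x \<in> T"
  shows "norm (b x) \<le> M * size_pair x powr (- \<eta>)"
proof -
  have xN: "x \<in> Npairs" using x T by auto
  define l1 where "l1 y = ln (real (fst y))" for y :: "nat \<times> nat"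
  define l2 where "l2 y = ln (real (snd y))" for y :: "nat \<times> nat"
  obtain \<tau>1 \<tau>2 where \<tau>: "\<And>y k. y \<in> Npairs \<Longrightarrow> y \<noteq> x \<Longrightarrow>
      \<tau>1 * (l1 x - l1 y) + \<tau>2 * (l2 x - l2 y) \<noteq> 2 * of_int k * pi"
    using generic_shift[OF xN] unfolding l1_def l2_def by blast
  \<comment> \<open>\<open>z y\<close> is the factor by which the term of \<open>y\<close>, measured
    relative to that of \<open>x\<close>, changes with each step of the progression; genericity
    keeps it away from 1 for every other \<open>y\<close> in \<open>T\<close>.\<close>
  define z where "z y = exp (\<i> * of_real (\<tau>1 * (l1 x - l1 y) + \<tau>2 * (l2 x - l2 y)))" for y
  have norm_z: "norm (z y) = 1" for y unfolding z_def by (rule norm_exp_i_times)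
  have z_ne: "z y \<noteq> 1" if "y \<in> T" "y \<noteq> x" for y
    using \<tau>[of y] that T unfolding z_def by (auto simp: exp_eq_1)
  have z_x: "z x = 1" by (simp add: z_def)
  define t1 where "t1 j = \<i> * of_real (real j * \<tau>1)" for j
  define t2 where "t2 j = \<i> * of_real (real j * \<tau>2)" for j
  define D where "D = {t. - \<eta> < Re t}"
  \<comment> \<open>\<open>E j t\<close> is the reciprocal of
    \<open>dchar (t + t1 j) (t + t2 j) x\<close>: it cancels the character of \<open>x\<close>, so
    that this term stays equal to \<open>b x\<close>.\<close>
  define E where "E j t = exp ((t + t1 j) * of_real (l1 x) + (t + t2 j) * of_real (l2 x))" for j t
  define F where "F K t = (\<Sum>j<Suc K. G (t + t1 j) (t + t2 j) * E j t) / of_nat (Suc K)" for K t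
  have norm_E: "norm (E j t) = size_pair x powr Re t" for j t
    by (simp add: E_def t1_def t2_def size_pair_powr[OF xN] l1_def l2_def algebra_simps)
  have F_hol: "F K holomorphic_on D" for K
    unfolding F_def E_def D_def
    by (intro holomorphic_intros hol) (auto simp: t1_def t2_def)
  have F_bd: "norm (F K t) \<le> M * size_pair x powr Re t" if t: "t \<in> D" for K t
  proof -
    have "norm (\<Sum>j<Suc K. G (t + t1 j) (t + t2 j) * E j t)
        \<le> (\<Sum>j<Suc K. M * size_pair x powr Re t)"
    proof (intro sum_norm_le)
      fix j
      have "norm (G (t + t1 j) (t + t2 j)) \<le> M"
        using t by (intro bd) (auto simp: D_def t1_def t2_def)
      then show "norm (G (t + t1 j) (t + t2 j) * E j t) \<le> M * size_pair x powr Re t"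
        by (simp add: norm_mult norm_E mult_right_mono)
    qed
    also have "\<dots> = real (Suc K) * (M * size_pair x powr Re t)" by simp
    finally show ?thesis
      unfolding F_def norm_divide norm_of_nat by (simp add: pos_divide_le_eq mult.commute del: of_nat_Suc sum.lessThan_Suc)
  qed
  have F_lim: "(\<lambda>K. F K t) \<longlonglongrightarrow> b x" if t: "A \<le> Re t" for t
  proof -
    define B where "B y = b y * exp (t * of_real (l1 x - l1 y + (l2 x - l2 y)))" for y
    have tm: "b y * dchar (t + t1 j) (t + t2 j) y * E j t = B y * z y ^ j" if "y \<in> T" for y j
    proof -
      have y: "y \<in> Npairs" using that T by auto
      show ?thesis
        unfolding B_def E_def dchar_exp[OF y] z_def l1_def[symmetric] l2_def[symmetric]
        by (simp add: mult.assoc flip: exp_add exp_of_nat_mult)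
          (simp add: t1_def t2_def algebra_simps)
    qed
    show ?thesis
    proof (rule tendsto_has_sum_dominated)
      show "(\<lambda>y. norm (B y)) summable_on T"
      proof (rule summable_on_comparison_test[OF summable_on_cmult_left[OF sm]])
        fix y assume "y \<in> T"
        then have y: "y \<in> Npairs" using T by auto
        have "norm (B y) = norm (b y) * norm (dchar t t y) * size_pair x powr Re t"
          unfolding B_def norm_mult
          by (simp add: dchar_exp[OF y] size_pair_powr[OF xN] l1_def l2_def algebra_simps flip: exp_add)
        also have "\<dots> \<le> norm (b y) * size_pair y powr (- A) * size_pair x powr Re t"
          using norm_dchar_le[OF y t t] by (intro mult_right_mono mult_left_mono) auto
        finally show "norm (B y) \<le> norm (b y) * size_pair y powr (- A) * size_pair x powr Re t" .
      qed auto
      fix K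
      have "((\<lambda>y. (\<Sum>j<Suc K. b y * dchar (t + t1 j) (t + t2 j) y * E j t) / of_nat (Suc K))
          has_sum F K t) T"
        unfolding F_def divide_inverse
        by (intro has_sum_cmult_left has_sum_sum DS) (use t in \<open>auto simp: t1_def t2_def\<close>)
      then show "((\<lambda>y. B y * ((\<Sum>j<Suc K. z y ^ j) / of_nat (Suc K))) has_sum F K t) T"
        by (rule has_sum_cong[THEN iffD1, rotated]) (simp only: tm times_divide_eq_right sum_distrib_left)
    next
      fix K y
      have "norm (\<Sum>j<Suc K. z y ^ j) \<le> (\<Sum>j<Suc K. 1)"
        by (intro sum_norm_le) (simp add: norm_power norm_z)
      then show "norm ((\<Sum>j<Suc K. z y ^ j) / of_nat (Suc K)) \<le> 1"
        unfolding norm_divide norm_of_nat by (simp add: pos_divide_le_eq del: of_nat_Suc sum.lessThan_Suc)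
    next
      fix y assume y: "y \<in> T"
      show "(\<lambda>K. (\<Sum>j<Suc K. z y ^ j) / of_nat (Suc K)) \<longlonglongrightarrow> (if y = x then 1 else 0)"
      proof (cases "y = x")
        case True
        have "(\<Sum>j<Suc K. z y ^ j) / of_nat (Suc K) = 1" for K
          by (simp add: True z_x del: of_nat_Suc sum.lessThan_Suc)
        then show ?thesis by (simp only: True simp_thms if_True tendsto_const)
      next
        case False
        then show ?thesis using geometric_averages_tendsto_0[OF norm_z z_ne[OF y]] by simp
      qed
    next
      have "((\<lambda>y. B y * (if y = x then 1 else 0)) has_sum b x) {x}"
        using has_sum_finite[of "{x}" "\<lambda>y. B y * (if y = x then 1 else 0)"] by (simp add: B_def)
      then show "((\<lambda>y. B y * (if y = x then 1 else 0)) has_sum b x) T"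
        by (rule has_sum_cong_neutral[THEN iffD1, rotated 3]) (use x in auto)
    qed
  qed
  have D_open: "open D" unfolding D_def by (rule open_halfspace_Re_gt)
  \<comment> \<open>The majorant does not depend on \<open>K\<close>, so it bounds the averages
    uniformly on compact subsets of \<open>D\<close>, also to the left of \<open>A\<close>, where
    convergence of the series is not assumed.\<close>
  define HH where "HH = {h. h holomorphic_on D \<and> (\<forall>t\<in>D. norm (h t) \<le> M * size_pair x powr Re t)}"
  obtain g r where g: "g holomorphic_on D" "strict_mono (r :: nat \<Rightarrow> nat)"
    "\<And>t. t \<in> D \<Longrightarrow> (\<lambda>n. F (r n) t) \<longlonglongrightarrow> g t"
  proof (rule Montel[OF D_open, of HH F])
    fix C assume C: "compact C" "C \<subseteq> D"
    have "continuous_on C (\<lambda>t. M * size_pair x powr Re t)"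
      using size_pair_ge_1[OF xN] by (intro continuous_intros) auto
    then have "bounded ((\<lambda>t. M * size_pair x powr Re t) ` C)"
      using C compact_continuous_image compact_imp_bounded by blast
    then obtain B where "\<forall>t\<in>C. norm (M * size_pair x powr Re t) \<le> B"
      by (auto simp: bounded_iff)
    then have "\<forall>h\<in>HH. \<forall>t\<in>C. norm (h t) \<le> B"
      using C unfolding HH_def by fastforce
    then show "\<exists>B. \<forall>h\<in>HH. \<forall>t\<in>C. norm (h t) \<le> B" by blast
  qed (auto simp: HH_def F_hol F_bd)
  have g_eq: "g t = b x" if "t \<in> D" for t
  proof (rule analytic_continuation_open[where s = "{t. max A (- \<eta>) < Re t}" and s' = D
        and f = g and g = "\<lambda>_. b x"])
    show "{t. max A (- \<eta>) < Re t} \<noteq> {}"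
      by (auto intro!: exI[of _ "of_real (max A (- \<eta>) + 1)"])
    show "connected D" unfolding D_def by (intro convex_connected convex_halfspace_Re_gt)
    show "open {t. max A (- \<eta>) < Re t}" by (rule open_halfspace_Re_gt)
    fix t assume t: "t \<in> {t. max A (- \<eta>) < Re t}"
    then have "(\<lambda>n. F (r n) t) \<longlonglongrightarrow> b x"
      using LIMSEQ_subseq_LIMSEQ[OF F_lim g(2)] by (auto simp: o_def)
    moreover have "(\<lambda>n. F (r n) t) \<longlonglongrightarrow> g t" using t by (intro g(3)) (auto simp: D_def)
    ultimately show "g t = b x" using LIMSEQ_unique by blast
  qed (use that g D_open in \<open>auto simp: D_def open_halfspace_Re_gt\<close>)
  have le: "norm (b x) \<le> M * size_pair x powr r" if "- \<eta> < r" for r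
  proof -
    have rD: "of_real r \<in> D" using that by (simp add: D_def)
    have "norm (g (of_real r)) \<le> M * size_pair x powr r"
      using F_bd[OF rD] by (intro LIMSEQ_le_const2[OF tendsto_norm[OF g(3)[OF rD]]]) auto
    then show ?thesis using g_eq[OF rD] by simp
  qed
  \<comment> \<open>The edge is not in \<open>D\<close>, so the exponent -\<eta> is reached as the
    limit of -\<eta> + 1/(n+1).\<close>
  have "(\<lambda>n. M * size_pair x powr (- \<eta> + inverse (real (Suc n)))) \<longlonglongrightarrow> M * size_pair x powr (- \<eta> + 0)"
    using size_pair_ge_1[OF xN] LIMSEQ_inverse_real_of_nat by (intro tendsto_intros) auto
  then show ?thesis
    by (intro LIMSEQ_le_const[where a = "norm (b x)"]) (auto intro!: exI[of _ 0] le)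
qed

section \<open>Functions of Dirichlet polynomials\<close>

definition ppow :: "nat \<times> nat \<Rightarrow> nat \<Rightarrow> nat \<times> nat" where
  "ppow g j = (fst g ^ j, snd g ^ j)"

inductive_set submonoid :: "(nat \<times> nat) set \<Rightarrow> (nat \<times> nat) set" for S where
  one: "(1, 1) \<in> submonoid S"
| mult: "x \<in> submonoid S \<Longrightarrow> g \<in> S \<Longrightarrow> pmul g x \<in> submonoid S"

lemma pmul_assoc: "pmul (pmul x y) z = pmul x (pmul y z)"
  by (simp add: pmul_def)

lemma pmul_one [simp]: "pmul (1, 1) x = x" "pmul x (1, 1) = x"
  by (simp_all add: pmul_def)

lemma ppow_Suc: "ppow g (Suc j) = pmul g (ppow g j)"
  by (simp add: ppow_def pmul_def)

lemma ppow_in_Npairs: "g \<in> Npairs \<Longrightarrow> ppow g j \<in> Npairs"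
  by (cases g) (auto simp: ppow_def Npos_def Suc_le_eq)

lemma submonoid_mult: "x \<in> submonoid S \<Longrightarrow> y \<in> submonoid S \<Longrightarrow> pmul x y \<in> submonoid S"
  by (induction rule: submonoid.induct)
    (auto simp: pmul_assoc intro: submonoid.mult simp del: One_nat_def)

lemma submonoid_generator: "g \<in> S \<Longrightarrow> g \<in> submonoid S"
  using submonoid.mult[OF submonoid.one, of g S] by (simp del: One_nat_def)

lemma submonoid_in_Npairs:
  assumes "S \<subseteq> Npairs" "x \<in> submonoid S"
  shows "x \<in> Npairs"
  using assms(2)
  by (induction rule: submonoid.induct) (use assms(1) pmul_in_Npairs in \<open>auto simp: Npos_def\<close>)

text \<open>Commutativity collects all factors \<open>g\<close> of a product into a single
  power.\<close>

lemma submonoid_insert_subset: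
  "submonoid (insert g S) \<subseteq> (\<lambda>(j, x). pmul (ppow g j) x) ` (UNIV \<times> submonoid S)"
proof
  fix y assume "y \<in> submonoid (insert g S)"
  then show "y \<in> (\<lambda>(j, x). pmul (ppow g j) x) ` (UNIV \<times> submonoid S)"
  proof (induction rule: submonoid.induct)
    case one
    show ?case
      by (rule image_eqI[where x = "(0, 1, 1)"])
        (simp_all add: ppow_def pmul_def submonoid.one[simplified])
  next
    case (mult y h)
    then obtain j x where y: "y = pmul (ppow g j) x" "x \<in> submonoid S" by auto
    show ?case
    proof (cases "h = g")
      case True
      then have "pmul h y = pmul (ppow g (Suc j)) x" by (simp add: y ppow_Suc pmul_assoc)
      then show ?thesis using y by auto
    next
      case False
      then have "pmul h x \<in> submonoid S" using mult y by (auto intro: submonoid.mult)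
      moreover have "pmul h y = pmul (ppow g j) (pmul h x)"
        by (simp add: y pmul_def mult_ac)
      ultimately show ?thesis by auto
    qed
  qed
qed

lemma submonoid_empty: "submonoid {} = {(1, 1)}"
proof -
  have "x = (1, 1)" if "x \<in> submonoid {}" for x
    using that by (induction rule: submonoid.induct) auto
  then show ?thesis using submonoid.one by blast
qed

text \<open>By submultiplicativity, a new generator \<open>g\<close> multiplies the sum by at most
  the sum of \<open>W\<close> over the powers of \<open>g\<close>. Induction thus reduces the monoid
  to one generator at a time.\<close>

lemma summable_on_submonoid:
  fixes W :: "nat \<times> nat \<Rightarrow> real"
  assumes "finite S" "S \<subseteq> Npairs"
    and W0: "\<And>x. x \<in> Npairs \<Longrightarrow> 0 \<le> W x"
    and W_mult: "\<And>x y. x \<in> Npairs \<Longrightarrow> y \<in> Npairs \<Longrightarrow> W (pmul x y) \<le> W x * W y"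
    and W_pow: "\<And>g. g \<in> S \<Longrightarrow> summable (\<lambda>j. W (ppow g j))"
  shows "W summable_on submonoid S"
  using assms(1,2) W_pow
proof (induction S)
  case empty
  then show ?case by (simp add: submonoid_empty)
next
  case (insert g S)
  have IH: "W summable_on submonoid S" using insert by auto
  have g: "g \<in> Npairs" using insert by auto
  have sub: "x \<in> Npairs" if "x \<in> submonoid S" for x
    using submonoid_in_Npairs[OF _ that] insert by auto
  let ?\<pi> = "\<lambda>(j, x). pmul (ppow g j) x"
  have "(\<lambda>j. W (ppow g j)) summable_on UNIV"
    using insert.prems(2)[of g] W0 ppow_in_Npairs[OF g]
    by (subst summable_on_UNIV_nonneg_real_iff) auto
  then have "(\<lambda>(j, x). W (ppow g j) * W x) summable_on UNIV \<times> submonoid S"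
    using IH W0 ppow_in_Npairs[OF g] sub by (intro summable_on_times_nonneg) auto
  then have sm: "(\<lambda>z. W (?\<pi> z)) summable_on UNIV \<times> submonoid S"
  proof (rule summable_on_comparison_test)
    fix z assume "z \<in> (UNIV :: nat set) \<times> submonoid S"
    then obtain j x where z: "z = (j, x)" "x \<in> Npairs" using sub by auto
    show "W (?\<pi> z) \<le> (case z of (j, x) \<Rightarrow> W (ppow g j) * W x)"
      using W_mult[OF ppow_in_Npairs[OF g] z(2)] z(1) by simp
    show "0 \<le> W (?\<pi> z)"
      using W0[OF pmul_in_Npairs[OF ppow_in_Npairs[OF g] z(2)]] z(1) by simp
  qed
  \<comment> \<open>Factorisations need not be unique. \<open>V\<close> keeps one for each element,
    which turns the sum over the monoid into a subsum of the sum over pairs.\<close>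
  obtain V where V: "V \<subseteq> UNIV \<times> submonoid S" "inj_on ?\<pi> V" "submonoid (insert g S) = ?\<pi> ` V"
    using submonoid_insert_subset[of g S] unfolding subset_image_inj by blast
  show ?case
    unfolding V(3) summable_on_reindex[OF V(2)]
    using summable_on_subset_banach[OF sm V(1)] by (simp add: o_def)
qed

lemma size_pair_gt_1:
  assumes "x \<in> Npairs" "x \<noteq> (1, 1)"
  shows "1 < size_pair x"
proof -
  have "fst x * snd x \<noteq> 0" "fst x * snd x \<noteq> 1"
    using Npairs_pos[OF assms(1)] assms(2) by (auto simp: prod_eq_iff)
  then have "1 < fst x * snd x" by linarith
  then have "real 1 < real (fst x * snd x)" by (simp only: of_nat_less_iff)
  then show ?thesis by (simp add: size_pair_def)
qed

text \<open>Root test: the j-th root is \<open>q\<close> times an expression that tends to 1 by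
  admissibility, and \<open>q\<close> is below 1 because \<open>g\<close> differs from
  \<open>(1, 1)\<close>.\<close>

lemma summable_weight_powers:
  assumes \<omega>: "is_weight \<omega>" "admissible_weight \<omega>" and "0 < \<sigma>"
    and g: "g \<in> Npairs" "g \<noteq> (1, 1)"
  shows "summable (\<lambda>j. size_pair (ppow g j) powr (- \<sigma>) * \<omega> (fst (ppow g j)) (snd (ppow g j)))"
    (is "summable ?f")
proof (rule root_test_convergence')
  define q where "q = size_pair g powr (- \<sigma>)"
  note s1 = size_pair_gt_1[OF g]
  have q: "0 < q" "q < 1" using s1 \<open>0 < \<sigma>\<close> by (auto simp: q_def powr_less_one)
  have size: "size_pair (ppow g j) powr (- \<sigma>) = q ^ j" for j
  proof -
    have "size_pair (ppow g j) = size_pair g ^ j"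
      by (simp add: size_pair_def ppow_def power_mult_distrib)
    then show ?thesis
      using s1 by (simp add: q_def powr_power powr_realpow[symmetric] powr_powr mult.commute)
  qed
  have om1: "1 \<le> \<omega> (fst g ^ j) (snd g ^ j)" for j
    using \<omega>(1) ppow_in_Npairs[OF g(1), of j] by (auto simp: is_weight_def ppow_def)
  have root: "root j (norm (?f j)) = q * \<omega> (fst g ^ j) (snd g ^ j) powr (1 / real j)" if "j > 0" for j
  proof -
    have "norm (?f j) = q ^ j * \<omega> (fst g ^ j) (snd g ^ j)"
      unfolding size using q om1[of j] by (simp add: abs_mult ppow_def)
    then have "root j (norm (?f j)) = root j (q ^ j) * root j (\<omega> (fst g ^ j) (snd g ^ j))"
      by (simp only: real_root_mult)
    then show ?thesis
      using that q om1[of j] by (simp only: real_root_power_cancel[OF that] less_imp_le)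
        (simp add: root_powr_inverse)
  qed
  have "(\<lambda>j. q * \<omega> (fst g ^ j) (snd g ^ j) powr (1 / real j)) \<longlonglongrightarrow> q * 1"
    using \<omega>(2) g by (intro tendsto_mult_left) (auto simp: admissible_weight_def)
  then have "(\<lambda>j. root j (norm (?f j))) \<longlonglongrightarrow> q * 1"
    by (rule Lim_transform_eventually[OF _ eventually_mono[OF eventually_gt_at_top[of 0]]])
      (simp only: root)
  then have "limsup (\<lambda>j. ereal (root j (norm (?f j)))) = ereal q"
    by (intro lim_imp_Limsup) auto
  then show "limsup (\<lambda>j. ereal (root j (norm (?f j)))) < 1"
    using q by (simp add: one_ereal_def)
qed

text \<open>Any positive decay exponent absorbs the weight: the product of both factors is
  submultiplicative, so only the powers of single generators have to be summed.\<close>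

lemma summable_weight_submonoid:
  assumes \<omega>: "is_weight \<omega>" "admissible_weight \<omega>" and "0 < \<sigma>"
    and S: "finite S" "S \<subseteq> Npairs - {(1, 1)}"
  shows "(\<lambda>x. size_pair x powr (- \<sigma>) * \<omega> (fst x) (snd x)) summable_on submonoid S"
proof (rule summable_on_submonoid)
  have om1: "1 \<le> \<omega> (fst x) (snd x)" if "x \<in> Npairs" for x
    using \<omega>(1) that by (auto simp: is_weight_def)
  show "0 \<le> size_pair x powr (- \<sigma>) * \<omega> (fst x) (snd x)" if "x \<in> Npairs" for x
    using om1[OF that] by simp
  fix x y assume xy: "x \<in> Npairs" "y \<in> Npairs"
  have "\<omega> (fst (pmul x y)) (snd (pmul x y)) \<le> \<omega> (fst x) (snd x) * \<omega> (fst y) (snd y)"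
    using \<omega>(1) xy by (auto simp: is_weight_def pmul_def)
  then have "size_pair (pmul x y) powr (- \<sigma>) * \<omega> (fst (pmul x y)) (snd (pmul x y))
      \<le> size_pair (pmul x y) powr (- \<sigma>) * (\<omega> (fst x) (snd x) * \<omega> (fst y) (snd y))"
    by (intro mult_left_mono) auto
  also have "\<dots> = size_pair x powr (- \<sigma>) * \<omega> (fst x) (snd x) * (size_pair y powr (- \<sigma>) * \<omega> (fst y) (snd y))"
    using size_pair_ge_1[OF xy(1)] size_pair_ge_1[OF xy(2)]
    by (simp add: size_pair_mult powr_mult)
  finally show "size_pair (pmul x y) powr (- \<sigma>) * \<omega> (fst (pmul x y)) (snd (pmul x y))
      \<le> size_pair x powr (- \<sigma>) * \<omega> (fst x) (snd x) * (size_pair y powr (- \<sigma>) * \<omega> (fst y) (snd y))" .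
next
  fix g assume "g \<in> S"
  then show "summable (\<lambda>j. size_pair (ppow g j) powr (- \<sigma>) * \<omega> (fst (ppow g j)) (snd (ppow g j)))"
    using S \<open>0 < \<sigma>\<close> by (intro summable_weight_powers \<omega>) auto
qed (use S in auto)

section \<open>Holomorphy of Dirichlet series and composition with Dirichlet polynomials\<close>

lemma dchar_holomorphic:
  "x \<in> Npairs \<Longrightarrow> (\<lambda>t. dchar (c1 + t) (c2 + t) x) holomorphic_on D"
  unfolding dchar_exp by (intro holomorphic_intros)

text \<open>Both variables are translated by the same \<open>t\<close>, so one-variable theory
  suffices. The majorant \<open>C\<close> makes the finite partial sums converge uniformly on
  \<open>D\<close>, and holomorphy passes to the limit.\<close>

lemma dirichlet_series_holomorphic:
  fixes b :: "nat \<times> nat \<Rightarrow> complex"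
  assumes T: "T \<subseteq> Npairs" and D: "open D"
    and bd: "\<And>x t. x \<in> T \<Longrightarrow> t \<in> D \<Longrightarrow> norm (b x * dchar (s1 + t) (s2 + t) x) \<le> C x"
    and C: "C summable_on T"
  shows "(\<lambda>t. \<Sum>\<^sub>\<infinity>x\<in>T. b x * dchar (s1 + t) (s2 + t) x) holomorphic_on D"
proof -
  have ul: "uniform_limit D (\<lambda>X t. \<Sum>x\<in>X. b x * dchar (s1 + t) (s2 + t) x)
      (\<lambda>t. \<Sum>\<^sub>\<infinity>x\<in>T. b x * dchar (s1 + t) (s2 + t) x) (finite_subsets_at_top T)"
    using bd C by (rule Weierstrass_m_test_general)
  have "(\<lambda>t. \<Sum>\<^sub>\<infinity>x\<in>T. b x * dchar (s1 + t) (s2 + t) x) analytic_on D"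
    unfolding analytic_on_def
  proof
    fix z assume "z \<in> D"
    then obtain r where r: "r > 0" "cball z r \<subseteq> D" using D by (meson open_contains_cball)
    have "(\<lambda>t. \<Sum>\<^sub>\<infinity>x\<in>T. b x * dchar (s1 + t) (s2 + t) x) holomorphic_on ball z r"
    proof (rule holomorphic_uniform_limit)
      have hol: "(\<lambda>t. \<Sum>x\<in>X. b x * dchar (s1 + t) (s2 + t) x) holomorphic_on E"
        if "X \<subseteq> T" for X E
        using that T by (intro holomorphic_intros dchar_holomorphic) auto
      show "\<forall>\<^sub>F X in finite_subsets_at_top T.
          continuous_on (cball z r) (\<lambda>t. \<Sum>x\<in>X. b x * dchar (s1 + t) (s2 + t) x) \<and>
          (\<lambda>t. \<Sum>x\<in>X. b x * dchar (s1 + t) (s2 + t) x) holomorphic_on ball z r"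
        by (rule eventually_finite_subsets_at_top_weakI)
          (blast intro: hol holomorphic_on_imp_continuous_on)
      show "uniform_limit (cball z r) (\<lambda>X t. \<Sum>x\<in>X. b x * dchar (s1 + t) (s2 + t) x)
          (\<lambda>t. \<Sum>\<^sub>\<infinity>x\<in>T. b x * dchar (s1 + t) (s2 + t) x) (finite_subsets_at_top T)"
        by (rule uniform_limit_on_subset[OF ul r(2)])
    qed auto
    then show "\<exists>e>0. (\<lambda>t. \<Sum>\<^sub>\<infinity>x\<in>T. b x * dchar (s1 + t) (s2 + t) x) holomorphic_on ball z e"
      using r by blast
  qed
  then show ?thesis by (rule analytic_imp_holomorphic)
qed

text \<open>Each \<open>x\<close> in \<open>S\<close> has size above 1, so its term vanishes far to
  the right. There a Dirichlet polynomial is as close as desired to its constant term.\<close>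

lemma dirichlet_polynomial_decay:
  fixes a :: "nat \<times> nat \<Rightarrow> complex"
  assumes S: "finite S" "S \<subseteq> Npairs - {(1, 1)}" and "0 < \<epsilon>"
  obtains A where "0 \<le> A" "(\<Sum>x\<in>S. norm (a x) * size_pair x powr (- A)) < \<epsilon>"
proof -
  have "(\<lambda>n. \<Sum>x\<in>S. norm (a x) * inverse (size_pair x) ^ n) \<longlonglongrightarrow> (\<Sum>x\<in>S. norm (a x) * 0)"
  proof (intro tendsto_sum tendsto_mult_left LIMSEQ_realpow_zero)
    fix x assume "x \<in> S"
    then have "1 < size_pair x" using S by (intro size_pair_gt_1) auto
    then show "0 \<le> inverse (size_pair x)" "inverse (size_pair x) < 1"
      by (auto simp: inverse_less_1_iff)
  qed
  then have "\<forall>\<^sub>F n in sequentially. (\<Sum>x\<in>S. norm (a x) * inverse (size_pair x) ^ n) < \<epsilon>"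
    using \<open>0 < \<epsilon>\<close> by (auto dest: order_tendstoD(2))
  then obtain n where n: "(\<Sum>x\<in>S. norm (a x) * inverse (size_pair x) ^ n) < \<epsilon>"
    by (auto simp: eventually_sequentially)
  have "inverse (size_pair x) ^ n = size_pair x powr (- real n)" if "x \<in> S" for x
    using size_pair_ge_1[of x] that S
    by (auto simp: powr_minus powr_realpow power_inverse)
  then have "(\<Sum>x\<in>S. norm (a x) * size_pair x powr (- real n)) < \<epsilon>"
    using n by (simp cong: sum.cong)
  then show ?thesis using that[of "real n"] by simp
qed

text \<open>The coefficients of \<open>\<psi> \<circ> P\<close> for a Dirichlet polynomial \<open>P\<close> are found by Taylor
  expansion at the constant term far to the right, and estimated through the bound of \<open>\<psi> \<circ> P\<close> on
  a half-plane that extends beyond \<open>Re s = 0\<close>.\<close>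

lemma compose_dirichlet_polynomial:
  fixes a :: "nat \<times> nat \<Rightarrow> complex" and c0 :: complex and S :: "(nat \<times> nat) set"
  defines "P \<equiv> \<lambda>s1 s2. c0 + (\<Sum>x\<in>S. a x * dchar s1 s2 x)"
  assumes S: "finite S" "S \<subseteq> Npairs - {(1, 1)}" and \<eta>: "0 < \<eta>"
    and U: "open U" "\<psi> holomorphic_on U" "c0 \<in> U"
    and PU: "\<And>s1 s2. - \<eta> < Re s1 \<Longrightarrow> - \<eta> < Re s2 \<Longrightarrow> P s1 s2 \<in> U"
    and PM: "\<And>s1 s2. - \<eta> < Re s1 \<Longrightarrow> - \<eta> < Re s2 \<Longrightarrow> norm (\<psi> (P s1 s2)) \<le> M"
  shows "\<exists>b. (\<forall>x\<in>submonoid S. norm (b x) \<le> M * size_pair x powr (- \<eta>)) \<and>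
    (\<forall>s1\<in>Hplane. \<forall>s2\<in>Hplane. ((\<lambda>x. b x * dchar s1 s2 x) has_sum \<psi> (P s1 s2)) (submonoid S))"
proof -
  let ?T = "submonoid S"
  have SN: "S \<subseteq> Npairs" using S by auto
  have TN: "x \<in> Npairs" if "x \<in> ?T" for x by (rule submonoid_in_Npairs[OF SN that])
  obtain \<rho> where \<rho>: "0 < \<rho>" "ball c0 \<rho> \<subseteq> U" using U by (meson open_contains_ball)
  have \<psi>_ball: "\<psi> holomorphic_on ball c0 \<rho>" using U(2) \<rho>(2) by (rule holomorphic_on_subset)
  \<comment> \<open>The Taylor series at \<open>c0\<close> converges at distance \<rho>/2, hence
    absolutely at every smaller distance; \<open>A\<close> is chosen so that \<open>P\<close> stays
    strictly within \<rho>/2 of \<open>c0\<close>.\<close>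
  obtain A where A: "0 \<le> A" "(\<Sum>x\<in>S. norm (a x) * size_pair x powr (- A)) < \<rho> / 2"
    using dirichlet_polynomial_decay[OF S, of "\<rho> / 2" a] \<rho> by auto
  define N where "N = (\<Sum>x\<in>S. norm (a x) * size_pair x powr (- A))"
  have N0: "0 \<le> N" unfolding N_def by (intro sum_nonneg) auto
  have N_lt: "N < \<rho> / 2" using A(2) by (simp add: N_def)
  define c where "c k = (deriv ^^ k) \<psi> c0 / fact k" for k
  \<comment> \<open>A Taylor coefficient is a constant, that is, a Dirichlet series supported at
    \<open>(1, 1)\<close>.\<close>
  define B where "B k y = (if y = (1, 1) then c k else 0)" for k and y :: "nat \<times> nat"
  have hs_one: "(F has_sum F (1, 1)) ?T" if "\<And>y. y \<noteq> (1, 1) \<Longrightarrow> F y = 0"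
    for F :: "nat \<times> nat \<Rightarrow> 'b::{comm_monoid_add,topological_space}"
  proof -
    have "(F has_sum F (1, 1)) {(1, 1)}" using has_sum_finite[of "{(1, 1)}" F] by simp
    then show ?thesis
      by (rule has_sum_cong_neutral[THEN iffD1, rotated 3]) (use submonoid.one[of S] that in auto)
  qed
  have Bsum: "((\<lambda>y. norm (B k y) powr 1 * size_pair y powr (- A)) has_sum norm (c k)) ?T" for k
    using hs_one[of "\<lambda>y. norm (B k y) powr 1 * size_pair y powr (- A)"]
    by (simp add: B_def size_pair_def)
  have conv: "summable (\<lambda>k. norm (c k) * N ^ k)"
  proof -
    have "summable (\<lambda>k. c k * (of_real (\<rho> / 2)) ^ k)"
      using holomorphic_power_series[OF \<psi>_ball, of "c0 + of_real (\<rho> / 2)"] \<rho>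
      by (auto simp: c_def dist_norm sums_iff)
    then have "summable (\<lambda>k. norm (c k * (of_real N) ^ k))"
      by (rule powser_insidea) (use N_lt N0 \<rho> in auto)
    then show ?thesis using N0 by (simp add: norm_mult norm_power)
  qed
  \<comment> \<open>The weight \<open>size_pair x powr (- A)\<close> dominates the modulus of
    \<open>dchar s1 s2 x\<close> once both real parts are at least \<open>A\<close>, so for the
    moment \<open>v\<close> represents the composition only in that region.\<close>
  have "\<exists>v. (\<lambda>x. norm (v x) powr 1 * size_pair x powr (- A)) summable_on ?T \<and>
    (\<forall>\<theta> H Z R. (\<forall>x\<in>?T. norm (\<theta> x) powr 1 \<le> size_pair x powr (- A)) \<longrightarrow>
       (\<forall>x\<in>?T. \<forall>y\<in>?T. \<theta> (pmul x y) = \<theta> x * \<theta> y) \<longrightarrow>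
       (\<forall>k. ((\<lambda>y. B k y * \<theta> y) has_sum H k) ?T) \<longrightarrow>
       ((\<lambda>x. a x * \<theta> x) has_sum Z) S \<longrightarrow> (\<lambda>k. H k * Z ^ k) sums R \<longrightarrow>
       ((\<lambda>x. v x * \<theta> x) has_sum R) ?T)"
  proof (rule series_of_powers_expansion)
    show "S \<subseteq> ?T" using submonoid_generator by auto
    show "((\<lambda>x. norm (a x) powr 1 * size_pair x powr (- A)) has_sum N) S"
      using has_sum_finite[OF S(1)] by (simp add: N_def)
    show "(\<lambda>y. norm (B k y) powr 1 * size_pair y powr (- A)) summable_on ?T" for k
      using Bsum by (rule has_sum_imp_summable)
    show "summable (\<lambda>k. (\<Sum>\<^sub>\<infinity>y\<in>?T. norm (B k y) powr 1 * size_pair y powr (- A)) * N ^ k)"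
      using conv by (simp only: infsumI[OF Bsum])
    fix x y assume xy: "x \<in> ?T" "y \<in> ?T"
    show "pmul x y \<in> ?T" by (rule submonoid_mult[OF xy])
    show "0 < size_pair x powr (- A)" using size_pair_ge_1[OF TN[OF xy(1)]] by simp
    show "size_pair (pmul x y) powr (- A) \<le> size_pair x powr (- A) * size_pair y powr (- A)"
      using size_pair_ge_1[OF TN[OF xy(1)]] size_pair_ge_1[OF TN[OF xy(2)]]
      by (simp add: size_pair_mult powr_mult)
  qed auto
  then obtain v where v1: "(\<lambda>x. norm (v x) powr 1 * size_pair x powr (- A)) summable_on ?T"
    and v2: "\<And>\<theta> H Z R. \<forall>x\<in>?T. norm (\<theta> x) powr 1 \<le> size_pair x powr (- A) \<Longrightarrow>
       \<forall>x\<in>?T. \<forall>y\<in>?T. \<theta> (pmul x y) = \<theta> x * \<theta> y \<Longrightarrow>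
       \<forall>k. ((\<lambda>y. B k y * \<theta> y) has_sum H k) ?T \<Longrightarrow>
       ((\<lambda>x. a x * \<theta> x) has_sum Z) S \<Longrightarrow> (\<lambda>k. H k * Z ^ k) sums R \<Longrightarrow>
       ((\<lambda>x. v x * \<theta> x) has_sum R) ?T"
    by blast
  have v1': "(\<lambda>x. norm (v x) * size_pair x powr (- A)) summable_on ?T" using v1 by simp
  have DS: "((\<lambda>x. v x * dchar s1 s2 x) has_sum \<psi> (P s1 s2)) ?T" if s: "A \<le> Re s1" "A \<le> Re s2" for s1 s2
  proof (rule v2)
    show "\<forall>x\<in>?T. norm (dchar s1 s2 x) powr 1 \<le> size_pair x powr (- A)"
      using norm_dchar_le[OF TN s] by simp
    show "\<forall>x\<in>?T. \<forall>y\<in>?T. dchar s1 s2 (pmul x y) = dchar s1 s2 x * dchar s1 s2 y"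
      using dchar_mult TN by blast
    show "\<forall>k. ((\<lambda>y. B k y * dchar s1 s2 y) has_sum c k) ?T"
      using hs_one[of "\<lambda>y. B _ y * dchar s1 s2 y"] by (simp add: B_def dchar_def)
    show "((\<lambda>x. a x * dchar s1 s2 x) has_sum P s1 s2 - c0) S"
      using has_sum_finite[OF S(1)] by (simp add: P_def)
    have "norm (P s1 s2 - c0) \<le> N"
      unfolding P_def N_def add_diff_cancel_left'
      by (intro sum_norm_le) (use SN in \<open>auto simp: norm_mult intro!: mult_left_mono norm_dchar_le s\<close>)
    then have "P s1 s2 \<in> ball c0 \<rho>"
      using A(2) \<rho>(1) by (simp add: dist_norm norm_minus_commute N_def)
    then show "(\<lambda>k. c k * (P s1 s2 - c0) ^ k) sums \<psi> (P s1 s2)"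
      using holomorphic_power_series[OF \<psi>_ball] unfolding c_def by blast
  qed
  have P_hol: "(\<lambda>t. \<psi> (P (c1 + t) (c2 + t))) holomorphic_on {t. \<sigma> < Re t}"
    if "0 \<le> Re c1 + \<eta> + \<sigma>" "0 \<le> Re c2 + \<eta> + \<sigma>" for c1 c2 \<sigma>
  proof -
    have "(\<lambda>t. P (c1 + t) (c2 + t)) holomorphic_on {t. \<sigma> < Re t}"
      unfolding P_def by (intro holomorphic_intros dchar_holomorphic) (use SN in auto)
    then have "(\<psi> \<circ> (\<lambda>t. P (c1 + t) (c2 + t))) holomorphic_on {t. \<sigma> < Re t}"
      by (rule holomorphic_on_compose_gen[OF _ U(2)]) (use that in \<open>auto intro!: PU\<close>)
    then show ?thesis by (simp add: o_def)
  qed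
  \<comment> \<open>The bound \<open>M\<close>, valid up to Re s = -\<eta>, replaces the crude
    summability known at \<open>A\<close>.\<close>
  have v_le: "norm (v x) \<le> M * size_pair x powr (- \<eta>)" if "x \<in> ?T" for x
  proof (rule dirichlet_coefficient_bound[OF _ v1' DS PM _ that])
    fix d1 d2 :: complex assume "Re d1 = 0" "Re d2 = 0"
    then show "(\<lambda>t. \<psi> (P (t + d1) (t + d2))) holomorphic_on {t. - \<eta> < Re t}"
      using P_hol[of d1 "- \<eta>" d2] by (simp add: add.commute)
  qed (use TN in auto)
  have "((\<lambda>x. v x * dchar s1 s2 x) has_sum \<psi> (P s1 s2)) ?T" if s: "s1 \<in> Hplane" "s2 \<in> Hplane" for s1 s2
  proof -
    \<comment> \<open>Half of the decay \<eta> is spent on letting \<open>t\<close> go left of 0, so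
      that 0 is an interior point of \<open>D\<close>; the other half is kept for summability over
      the monoid.\<close>
    define D where "D = {t. - (\<eta> / 2) < Re t}"
    define g where "g t = (\<Sum>\<^sub>\<infinity>x\<in>?T. v x * dchar (s1 + t) (s2 + t) x)" for t
    have is_w: "is_weight (\<lambda>_ _. 1)" "admissible_weight (\<lambda>_ _. 1)"
      by (auto simp: is_weight_def admissible_weight_def)
    have C: "(\<lambda>x. M * size_pair x powr (- (\<eta> / 2))) summable_on ?T"
      using summable_weight_submonoid[OF is_w _ S, of "\<eta> / 2"] \<eta>
      by (intro summable_on_cmult_right) auto
    have bd: "norm (v x * dchar (s1 + t) (s2 + t) x) \<le> M * size_pair x powr (- (\<eta> / 2))"
      if x: "x \<in> ?T" and t: "t \<in> D" for x t
    proof -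
      have "norm (v x * dchar (s1 + t) (s2 + t) x)
          \<le> (M * size_pair x powr (- \<eta>)) * size_pair x powr (- (- (\<eta> / 2)))"
        unfolding norm_mult using v_le[OF x] t s
        by (intro mult_mono norm_dchar_le TN x) (auto simp: D_def Hplane_def intro: order_trans[OF norm_ge_zero])
      also have "\<dots> = M * size_pair x powr (- (\<eta> / 2))"
        by (simp flip: powr_add)
      finally show ?thesis .
    qed
    have g_hol: "g holomorphic_on D"
      unfolding g_def using TN by (intro dirichlet_series_holomorphic[OF _ _ bd C])
        (auto simp: D_def open_halfspace_Re_gt)
    have 0: "0 \<in> D" using \<eta> by (simp add: D_def)
    \<comment> \<open>Both sides are holomorphic on \<open>D\<close> and agree for Re t >
      \<open>A\<close>, so the identity theorem carries the representation to t = 0.\<close>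
    have "g 0 = \<psi> (P (s1 + 0) (s2 + 0))"
    proof (rule analytic_continuation_open[where s = "{t. A < Re t}" and s' = D and f = g
          and g = "\<lambda>t. \<psi> (P (s1 + t) (s2 + t))"])
      show "{t. A < Re t} \<noteq> {}" by (auto intro!: exI[of _ "of_real (A + 1)"])
      show "connected D" unfolding D_def by (intro convex_connected convex_halfspace_Re_gt)
      show "(\<lambda>t. \<psi> (P (s1 + t) (s2 + t))) holomorphic_on D"
        unfolding D_def by (rule P_hol) (use s \<eta> in \<open>auto simp: Hplane_def\<close>)
      fix t assume "t \<in> {t. A < Re t}"
      then show "g t = \<psi> (P (s1 + t) (s2 + t))"
        unfolding g_def by (intro infsumI DS) (use s in \<open>auto simp: Hplane_def\<close>)
    qed (use g_hol 0 A \<eta> in \<open>auto simp: D_def open_halfspace_Re_gt\<close>)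
    moreover have "(\<lambda>x. v x * dchar s1 s2 x) summable_on ?T"
    proof (rule abs_summable_summable, rule summable_on_comparison_test[OF C])
      show "norm (v x * dchar s1 s2 x) \<le> M * size_pair x powr (- (\<eta> / 2))" if "x \<in> ?T" for x
        using bd[OF that 0] by simp
    qed auto
    ultimately show ?thesis by (simp add: g_def has_sum_iff)
  qed
  then show ?thesis using v_le by blast
qed

section \<open>Holomorphic functional calculus\<close>

text \<open>The divisibility clause is so strong that it forces the weight to be bounded:
  \<open>\<omega> m n \<le> K * \<omega> m 1 \<le> K\<^sup>2 * \<omega> 1 1\<close>. So every almost monotone weight is admissible.\<close>

lemma almost_monotone_imp_admissible:
  assumes "almost_monotone_weight \<omega>"
  shows "admissible_weight \<omega>"
proof (cases "admissible_weight \<omega>")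
  case False
  then obtain K where K: "K > 0"
    and K_mono: "\<forall>m1\<in>Npos. \<forall>n1\<in>Npos. \<forall>m2\<in>Npos. \<forall>n2\<in>Npos.
      (m1 dvd m2 \<or> n1 dvd n2) \<longrightarrow> \<omega> m1 n1 \<le> K * \<omega> m2 n2"
    using assms unfolding almost_monotone_weight_def by auto
  note mono = K_mono[rule_format]
  have one: "1 \<in> Npos" by (simp add: Npos_def)
  have ge1: "1 \<le> \<omega> m n" if "m \<in> Npos" "n \<in> Npos" for m n
    using assms that by (auto simp: almost_monotone_weight_def is_weight_def)
  define C where "C = K * (K * \<omega> 1 1)"
  have bound: "\<omega> m n \<le> C" if "m \<in> Npos" "n \<in> Npos" for m n
  proof -
    \<comment> \<open>Divisibility in one coordinate is enough: \<open>m dvd m\<close> lets n be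
      replaced by 1, and then \<open>1 dvd 1\<close> lets m be replaced by 1.\<close>
    have "\<omega> m n \<le> K * \<omega> m 1" by (rule mono) (use that one in auto)
    also have "\<dots> \<le> C"
      unfolding C_def by (intro mult_left_mono mono) (use that one K in auto)
    finally show ?thesis .
  qed
  have C1: "1 \<le> C" using ge1[OF one one] bound[OF one one] by simp
  show ?thesis
    unfolding admissible_weight_def
  proof (intro ballI)
    fix l k assume lk: "l \<in> Npos" "k \<in> Npos"
    have pw: "l ^ j \<in> Npos" "k ^ j \<in> Npos" for j
      using lk by (auto simp: Npos_def Suc_le_eq)
    show "(\<lambda>j. \<omega> (l ^ j) (k ^ j) powr (1 / real j)) \<longlonglongrightarrow> 1"
    proof (rule tendsto_sandwich)
      show "\<forall>\<^sub>F j in sequentially. 1 \<le> \<omega> (l ^ j) (k ^ j) powr (1 / real j)"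
        using ge1[OF pw] by (intro always_eventually allI ge_one_powr_ge_zero) auto
      show "\<forall>\<^sub>F j in sequentially. \<omega> (l ^ j) (k ^ j) powr (1 / real j) \<le> C powr (1 / real j)"
        using bound[OF pw] ge1[OF pw]
        by (intro always_eventually allI powr_mono2) (auto intro: order_trans[OF zero_le_one])
      have "(\<lambda>j. C powr (1 / real j)) \<longlonglongrightarrow> C powr 0"
        using C1 lim_1_over_n by (intro tendsto_powr) auto
      then show "(\<lambda>j. C powr (1 / real j)) \<longlonglongrightarrow> 1" using C1 by simp
    qed auto
  qed
qed

section \<open>From Dirichlet polynomials to the full series\<close>

lemma has_p_omega_DS_iff:
  "has_p_omega_DS p \<omega> f \<longleftrightarrow>
    (\<exists>a. (\<lambda>x. norm (a x) powr p * \<omega> (fst x) (snd x)) summable_on Npairs \<and>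
      (\<forall>s1\<in>Hplane. \<forall>s2\<in>Hplane. ((\<lambda>x. a x * dchar s1 s2 x) has_sum f s1 s2) Npairs))"
  (is "?L \<longleftrightarrow> ?R")
proof
  assume ?L
  then obtain a where "(\<lambda>(m, n). norm (a m n) powr p * \<omega> m n) summable_on Npairs"
    "\<forall>s1\<in>Hplane. \<forall>s2\<in>Hplane.
       ((\<lambda>(m, n). a m n * of_nat m powr (- s1) * of_nat n powr (- s2)) has_sum f s1 s2) Npairs"
    unfolding has_p_omega_DS_def by blast
  then show ?R
    by (intro exI[of _ "\<lambda>x. a (fst x) (snd x)"]) (simp add: case_prod_unfold dchar_def mult.assoc)
next
  assume ?R
  then obtain a where "(\<lambda>x. norm (a x) powr p * \<omega> (fst x) (snd x)) summable_on Npairs"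
    "\<forall>s1\<in>Hplane. \<forall>s2\<in>Hplane. ((\<lambda>x. a x * dchar s1 s2 x) has_sum f s1 s2) Npairs"
    by blast
  then show ?L
    unfolding has_p_omega_DS_def
    by (intro exI[of _ "\<lambda>m n. a (m, n)"]) (simp add: case_prod_unfold dchar_def mult.assoc)
qed

lemma norm_dchar_le_1:
  assumes "x \<in> Npairs" "s1 \<in> Hplane" "s2 \<in> Hplane"
  shows "norm (dchar s1 s2 x) \<le> 1"
  using norm_dchar_le[OF assms(1), of 0 s1 s2] size_pair_ge_1[OF assms(1)] assms(2,3)
  by (simp add: Hplane_def)

lemma dchar_shift:
  assumes "x \<in> Npairs"
  shows "dchar s1 s2 x = dchar (s1 + of_real \<eta>) (s2 + of_real \<eta>) x * of_real (size_pair x powr \<eta>)"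
  using assms
  by (simp add: dchar_exp size_pair_powr exp_of_real[symmetric] algebra_simps flip: exp_add)

text \<open>The comparison point is the translate by \<eta>. Characters have modulus at most 1
  there, so the term of \<open>x\<close> changes by at most
  \<open>norm (a x) * (size_pair x powr \<eta> - 1)\<close>, a bound free of \<open>s1\<close> and
  \<open>s2\<close> that tends to 0 with \<eta>.\<close>

lemma dirichlet_polynomial_shift:
  fixes a :: "nat \<times> nat \<Rightarrow> complex"
  assumes S: "S \<subseteq> Npairs" and "0 < \<delta>"
  obtains \<eta> where "0 < \<eta>" "\<And>s1 s2. - \<eta> < Re s1 \<Longrightarrow> - \<eta> < Re s2 \<Longrightarrow>
    \<exists>s1'\<in>Hplane. \<exists>s2'\<in>Hplane.
      norm ((\<Sum>x\<in>S. a x * dchar s1 s2 x) - (\<Sum>x\<in>S. a x * dchar s1' s2' x)) < \<delta>"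
proof -
  have sz: "1 \<le> size_pair x" if "x \<in> S" for x using that S size_pair_ge_1 by auto
  have "((\<lambda>\<eta>. \<Sum>x\<in>S. norm (a x) * (size_pair x powr \<eta> - 1))
      \<longlongrightarrow> (\<Sum>x\<in>S. norm (a x) * (size_pair x powr 0 - 1))) (at_right 0)"
    by (intro tendsto_sum tendsto_mult_left tendsto_diff tendsto_powr tendsto_const tendsto_ident_at)
      (use sz in force)
  moreover have "(\<Sum>x\<in>S. norm (a x) * (size_pair x powr 0 - 1)) = 0"
    using sz by (intro sum.neutral) fastforce
  ultimately have "\<forall>\<^sub>F \<eta> in at_right 0. (\<Sum>x\<in>S. norm (a x) * (size_pair x powr \<eta> - 1)) < \<delta>"
    using \<open>0 < \<delta>\<close> by (auto dest: order_tendstoD(2))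
  then obtain b where b: "b > 0" "\<And>\<eta>. 0 < \<eta> \<Longrightarrow> \<eta> < b \<Longrightarrow>
      (\<Sum>x\<in>S. norm (a x) * (size_pair x powr \<eta> - 1)) < \<delta>"
    unfolding eventually_at_right_field by auto
  define \<eta> where "\<eta> = b / 2"
  have \<eta>: "0 < \<eta>" "(\<Sum>x\<in>S. norm (a x) * (size_pair x powr \<eta> - 1)) < \<delta>"
    using b(1) b(2)[of \<eta>] by (auto simp: \<eta>_def)
  show ?thesis
  proof (rule that[OF \<eta>(1)])
    fix s1 s2 assume s: "- \<eta> < Re s1" "- \<eta> < Re s2"
    define s1' where "s1' = s1 + of_real \<eta>"
    define s2' where "s2' = s2 + of_real \<eta>"
    have s': "s1' \<in> Hplane" "s2' \<in> Hplane" using s by (auto simp: s1'_def s2'_def Hplane_def)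
    have "norm (\<Sum>x\<in>S. a x * (dchar s1 s2 x - dchar s1' s2' x))
        \<le> (\<Sum>x\<in>S. norm (a x) * (size_pair x powr \<eta> - 1))"
    proof (intro sum_norm_le)
      fix x assume x: "x \<in> S"
      then have xN: "x \<in> Npairs" using S by auto
      have ge: "1 \<le> size_pair x powr \<eta>"
        using sz[OF x] \<eta>(1) by (intro ge_one_powr_ge_zero) auto
      have "dchar s1 s2 x - dchar s1' s2' x = dchar s1' s2' x * of_real (size_pair x powr \<eta> - 1)"
        using dchar_shift[OF xN, of s1 s2 \<eta>] by (simp add: s1'_def s2'_def algebra_simps)
      then have "norm (dchar s1 s2 x - dchar s1' s2' x)
          = norm (dchar s1' s2' x) * (size_pair x powr \<eta> - 1)"
        using ge by (simp add: norm_mult del: of_real_diff)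
      also have "\<dots> \<le> 1 * (size_pair x powr \<eta> - 1)"
        using ge norm_dchar_le_1[OF xN s'] by (intro mult_right_mono) auto
      finally show "norm (a x * (dchar s1 s2 x - dchar s1' s2' x))
          \<le> norm (a x) * (size_pair x powr \<eta> - 1)"
        by (simp add: norm_mult mult_left_mono)
    qed
    then have "norm ((\<Sum>x\<in>S. a x * dchar s1 s2 x) - (\<Sum>x\<in>S. a x * dchar s1' s2' x)) < \<delta>"
      using \<eta>(2) by (simp add: right_diff_distrib sum_subtractf)
    then show "\<exists>s1'\<in>Hplane. \<exists>s2'\<in>Hplane.
      norm ((\<Sum>x\<in>S. a x * dchar s1 s2 x) - (\<Sum>x\<in>S. a x * dchar s1' s2' x)) < \<delta>"
      using s' by blast
  qed
qed

text \<open>The point \<open>x0\<close> is forced into \<open>F\<close> so that the constant term of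
  a series goes to the polynomial and the tail contains only other terms.\<close>

lemma summable_on_small_tail:
  fixes u :: "'a \<Rightarrow> real"
  assumes u: "u summable_on A" "\<And>x. x \<in> A \<Longrightarrow> 0 \<le> u x" and "0 < \<epsilon>" "x0 \<in> A"
  obtains F where "finite F" "F \<subseteq> A" "x0 \<in> F" "infsum u (A - F) < \<epsilon>"
proof -
  obtain F where F: "finite F" "F \<subseteq> A" "dist (sum u F) (infsum u A) \<le> \<epsilon> / 2"
    using infsum_finite_approximation[OF u(1), of "\<epsilon> / 2"] \<open>0 < \<epsilon>\<close> by auto
  let ?G = "insert x0 F"
  have G: "finite ?G" "?G \<subseteq> A" using F \<open>x0 \<in> A\<close> by auto
  have "infsum u (A - ?G) = infsum u A - sum u ?G"
    using infsum_Diff[OF u(1) _ G(2)] G(1) by simp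
  also have "\<dots> \<le> infsum u A - sum u F"
    using G u(2) by (intro diff_left_mono sum_mono2) auto
  also have "\<dots> < \<epsilon>" using F(3) \<open>0 < \<epsilon>\<close> unfolding dist_real_def by linarith
  finally show ?thesis using that[OF G] by auto
qed

lemma holomorphic_calculus_dirichlet:
  fixes f :: "complex \<Rightarrow> complex \<Rightarrow> complex"
  assumes p: "0 < p" "p \<le> 1" and \<omega>: "is_weight \<omega>" "admissible_weight \<omega>"
    and f: "has_p_omega_DS p \<omega> f"
    and U: "open U" "closure {f s1 s2 | s1 s2. s1 \<in> Hplane \<and> s2 \<in> Hplane} \<subseteq> U"
    and \<phi>: "\<phi> holomorphic_on U"
  shows "has_p_omega_DS p \<omega> (\<lambda>s1 s2. \<phi> (f s1 s2))"
proof -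
  define w where "w x = \<omega> (fst x) (snd x)" for x
  have w1: "1 \<le> w x" if "x \<in> Npairs" for x
    using \<omega>(1) that by (auto simp: w_def is_weight_def)
  have w0: "0 \<le> w x" if "x \<in> Npairs" for x using w1[OF that] by simp
  have w_mult: "w (pmul x y) \<le> w x * w y" if "x \<in> Npairs" "y \<in> Npairs" for x y
    using \<omega>(1) that by (auto simp: w_def is_weight_def pmul_def)
  obtain a where a: "(\<lambda>x. norm (a x) powr p * w x) summable_on Npairs"
    and a_sum: "\<And>s1 s2. s1 \<in> Hplane \<Longrightarrow> s2 \<in> Hplane \<Longrightarrow>
      ((\<lambda>x. a x * dchar s1 s2 x) has_sum f s1 s2) Npairs"
    using f unfolding has_p_omega_DS_iff w_def by blast
  have powr_le_w: "norm c powr p \<le> norm c powr p * w x" if "x \<in> Npairs" for c :: complex and x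
    using mult_left_mono[OF w1[OF that], of "norm c powr p"] by simp
  have ap: "(\<lambda>x. norm (a x) powr p) summable_on Npairs"
    by (rule summable_on_comparison_test[OF a]) (auto intro!: powr_le_w)
  have a_abs: "(\<lambda>x. norm (a x)) summable_on Npairs"
    by (rule summable_on_of_powr(1)[OF p _ ap]) auto
  have tail_le: "norm Z \<le> infsum (\<lambda>x. norm (a x)) X"
    if "((\<lambda>x. a x * dchar s1 s2 x) has_sum Z) X" "X \<subseteq> Npairs" "s1 \<in> Hplane" "s2 \<in> Hplane" for X Z s1 s2
  proof (rule norm_infsum_le[OF that(1)])
    show "((\<lambda>x. norm (a x)) has_sum infsum (\<lambda>x. norm (a x)) X) X"
      by (rule has_sum_infsum[OF summable_on_subset_banach[OF a_abs that(2)]])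
    fix x assume "x \<in> X"
    then show "norm (a x * dchar s1 s2 x) \<le> norm (a x)"
      using mult_left_mono[OF norm_dchar_le_1[of x s1 s2], of "norm (a x)"] that(2-4)
      by (auto simp: norm_mult)
  qed
  define K where "K = closure {f s1 s2 | s1 s2. s1 \<in> Hplane \<and> s2 \<in> Hplane}"
  have fK: "f s1 s2 \<in> K" if "s1 \<in> Hplane" "s2 \<in> Hplane" for s1 s2
    unfolding K_def using that by (intro subsetD[OF closure_subset]) auto
  \<comment> \<open>Characters have modulus at most 1 on \<open>Hplane\<close>, so \<open>f\<close>
    is bounded by the sum of the coefficient norms. Compactness of \<open>K\<close> then yields a
    uniform distance \<epsilon> to the outside of \<open>U\<close>.\<close>
  have "bounded {f s1 s2 | s1 s2. s1 \<in> Hplane \<and> s2 \<in> Hplane}"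
    unfolding bounded_iff using tail_le[OF a_sum subset_refl] by blast
  then have K: "compact K" unfolding K_def by simp
  obtain \<epsilon> where \<epsilon>: "0 < \<epsilon>" "(\<Union>x\<in>K. ball x \<epsilon>) \<subseteq> U"
    using compact_subset_open_imp_ball_epsilon_subset[OF K U(1)] U(2) unfolding K_def by blast
  \<comment> \<open>Three steps of length \<delta> lead away from \<open>K\<close>: from
    \<open>f\<close> to \<open>P\<close>, across the edge, and across a Cauchy disc. Since 3\<delta>
    < \<epsilon>, the closed neighbourhood \<open>K'\<close> stays inside \<open>U\<close>.\<close>
  define \<delta> where "\<delta> = \<epsilon> / 4"
  have \<delta>: "0 < \<delta>" using \<epsilon> by (simp add: \<delta>_def)
  define K' where "K' = {x + y | x y. x \<in> K \<and> y \<in> cball 0 (3 * \<delta>)}"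
  have K'I: "z \<in> K'" if "x \<in> K" "norm (z - x) \<le> 3 * \<delta>" for x z
    unfolding K'_def mem_Collect_eq by (rule exI[of _ x], rule exI[of _ "z - x"]) (use that in simp)
  have K'U: "K' \<subseteq> U"
  proof
    fix z assume "z \<in> K'"
    then obtain x where x: "x \<in> K" "norm (z - x) \<le> 3 * \<delta>" by (auto simp: K'_def)
    then have "z \<in> ball x \<epsilon>" using \<epsilon>(1) by (simp add: \<delta>_def dist_norm norm_minus_commute)
    then show "z \<in> U" using \<epsilon>(2) x(1) by blast
  qed
  have "compact K'" unfolding K'_def by (intro compact_sums K compact_cball)
  then have "bounded (\<phi> ` K')"
    by (intro compact_imp_bounded compact_continuous_image
        continuous_on_subset[OF holomorphic_on_imp_continuous_on[OF \<phi>] K'U])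
  then obtain M where M: "\<And>z. z \<in> K' \<Longrightarrow> norm (\<phi> z) \<le> M" by (auto simp: bounded_iff)

  have "(1, 1) \<in> Npairs" by (simp add: Npos_def)
  \<comment> \<open>The threshold \<open>\<delta> powr p\<close> serves twice: it makes the ratio of
    the final geometric series less than 1, and it makes the tail smaller than \<delta> in modulus,
    so that \<open>f\<close> lies in the disc of convergence about \<open>P\<close>.\<close>
  then obtain F where F: "finite F" "F \<subseteq> Npairs" "(1, 1) \<in> F"
    and F_tail: "(\<Sum>\<^sub>\<infinity>x\<in>Npairs - F. norm (a x) powr p * w x) < \<delta> powr p"
    by (rule summable_on_small_tail[OF a, of "\<delta> powr p" "(1, 1)", rotated 2])
      (use \<delta> w0 in auto)
  define Q where "Q = Npairs - F"
  define S where "S = F - {(1, 1)}"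
  have S: "finite S" "S \<subseteq> Npairs - {(1, 1)}" using F by (auto simp: S_def)
  have QN: "Q \<subseteq> Npairs" by (auto simp: Q_def)
  define N where "N = (\<Sum>\<^sub>\<infinity>x\<in>Q. norm (a x) powr p * w x)"
  have aQ: "(\<lambda>x. norm (a x) powr p * w x) summable_on Q" by (rule summable_on_subset_banach[OF a QN])
  have N: "0 \<le> N" "N < \<delta> powr p"
    unfolding N_def using F_tail QN w0 by (auto simp: Q_def intro!: infsum_nonneg mult_nonneg_nonneg)
  have tail: "infsum (\<lambda>x. norm (a x)) Q < \<delta>"
  proof (rule ccontr)
    assume "\<not> infsum (\<lambda>x. norm (a x)) Q < \<delta>"
    then have "\<delta> powr p \<le> infsum (\<lambda>x. norm (a x)) Q powr p"
      using \<delta> p by (intro powr_mono2) auto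
    also have "\<dots> \<le> (\<Sum>\<^sub>\<infinity>x\<in>Q. norm (a x) powr p)"
      by (rule summable_on_of_powr(2)[OF p _ summable_on_subset_banach[OF ap QN]]) auto
    also have "\<dots> \<le> N"
      unfolding N_def using QN
      by (intro infsum_mono summable_on_subset_banach[OF ap QN] aQ powr_le_w) auto
    finally show False using N(2) by simp
  qed

  define P where "P s1 s2 = a (1, 1) + (\<Sum>x\<in>S. a x * dchar s1 s2 x)" for s1 s2
  have P_F: "P s1 s2 = (\<Sum>x\<in>F. a x * dchar s1 s2 x)" for s1 s2
    using F by (simp add: P_def S_def sum.remove[of F "(1, 1)"] dchar_def)
  have Z_sum: "((\<lambda>x. a x * dchar s1 s2 x) has_sum f s1 s2 - P s1 s2) Q"
    if "s1 \<in> Hplane" "s2 \<in> Hplane" for s1 s2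
    unfolding P_F Q_def
    by (rule has_sum_Diff[OF a_sum[OF that] has_sum_finite[OF F(1)] F(2)])
  have Z_lt: "norm (f s1 s2 - P s1 s2) < \<delta>" if "s1 \<in> Hplane" "s2 \<in> Hplane" for s1 s2
    using tail_le[OF Z_sum[OF that] QN that] tail by simp
  obtain \<eta> where \<eta>: "0 < \<eta>" and shift: "\<And>s1 s2. - \<eta> < Re s1 \<Longrightarrow> - \<eta> < Re s2 \<Longrightarrow>
    \<exists>s1'\<in>Hplane. \<exists>s2'\<in>Hplane.
      norm ((\<Sum>x\<in>S. a x * dchar s1 s2 x) - (\<Sum>x\<in>S. a x * dchar s1' s2' x)) < \<delta>"
    using dirichlet_polynomial_shift[of S \<delta> a] S \<delta> by blast
  have P_near: "\<exists>x\<in>K. norm (P s1 s2 - x) < 2 * \<delta>" if s: "- \<eta> < Re s1" "- \<eta> < Re s2" for s1 s2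
  proof -
    obtain s1' s2' where s': "s1' \<in> Hplane" "s2' \<in> Hplane" "norm (P s1 s2 - P s1' s2') < \<delta>"
      using shift[OF s] unfolding P_def by auto
    have "norm (P s1 s2 - f s1' s2') \<le> norm (P s1 s2 - P s1' s2') + norm (P s1' s2' - f s1' s2')"
      using norm_triangle_ineq[of "P s1 s2 - P s1' s2'" "P s1' s2' - f s1' s2'"] by simp
    then have "norm (P s1 s2 - f s1' s2') < 2 * \<delta>"
      using s'(3) Z_lt[OF s'(1,2)] by (simp add: norm_minus_commute)
    then show ?thesis using fK[OF s'(1,2)] by blast
  qed
  have P_cball: "cball (P s1 s2) \<delta> \<subseteq> K'" if s: "- \<eta> < Re s1" "- \<eta> < Re s2" for s1 s2
  proof
    fix z assume z: "z \<in> cball (P s1 s2) \<delta>"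
    obtain x where x: "x \<in> K" "norm (P s1 s2 - x) < 2 * \<delta>" using P_near[OF s] by blast
    have "norm (z - x) \<le> norm (z - P s1 s2) + norm (P s1 s2 - x)"
      using norm_triangle_ineq[of "z - P s1 s2" "P s1 s2 - x"] by simp
    then show "z \<in> K'"
      using x z by (intro K'I[OF x(1)]) (simp add: dist_norm norm_minus_commute)
  qed
  \<comment> \<open>The constant term need not be a value of \<open>P\<close>, but it is the limit
    of \<open>P\<close> far to the right, hence within \<delta> of such a value.\<close>
  have "a (1, 1) \<in> U"
  proof -
    obtain A where A: "0 \<le> A" "(\<Sum>x\<in>S. norm (a x) * size_pair x powr (- A)) < \<delta>"
      using dirichlet_polynomial_decay[OF S \<delta>] .
    have "norm (\<Sum>x\<in>S. a x * dchar (of_real A) (of_real A) x)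
        \<le> (\<Sum>x\<in>S. norm (a x) * size_pair x powr (- A))"
      using S by (intro sum_norm_le) (auto simp: norm_mult intro!: mult_left_mono norm_dchar_le)
    then have "a (1, 1) \<in> cball (P (of_real A) (of_real A)) \<delta>"
      using A(2) by (simp add: P_def dist_norm)
    then show ?thesis using P_cball[of "of_real A" "of_real A"] A(1) \<eta> K'U by auto
  qed

  define h where "h k z = (deriv ^^ k) \<phi> z / fact k" for k z
  have h_hol: "h k holomorphic_on U" for k
    unfolding h_def by (intro holomorphic_intros holomorphic_higher_deriv \<phi> U(1)) auto
  have \<phi>_ball: "\<phi> holomorphic_on ball (P s1 s2) \<delta>" "continuous_on (cball (P s1 s2) \<delta>) \<phi>"
    if s: "- \<eta> < Re s1" "- \<eta> < Re s2" for s1 s2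
  proof -
    have "cball (P s1 s2) \<delta> \<subseteq> U" using P_cball[OF s] K'U by (rule order_trans)
    moreover from this have "ball (P s1 s2) \<delta> \<subseteq> U" by (rule order_trans[OF ball_subset_cball])
    ultimately show "\<phi> holomorphic_on ball (P s1 s2) \<delta>" "continuous_on (cball (P s1 s2) \<delta>) \<phi>"
      using holomorphic_on_subset[OF \<phi>]
        continuous_on_subset[OF holomorphic_on_imp_continuous_on[OF \<phi>]] by blast+
  qed
  have h_le: "norm (h k (P s1 s2)) \<le> M / \<delta> ^ k" if s: "- \<eta> < Re s1" "- \<eta> < Re s2" for k s1 s2
  proof -
    have "norm ((deriv ^^ k) \<phi> (P s1 s2)) \<le> fact k * M / \<delta> ^ k"
      by (rule Cauchy_inequality[OF \<phi>_ball[OF s] \<delta>])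
        (use P_cball[OF s] M in \<open>auto simp: dist_norm subset_iff\<close>)
    then show ?thesis by (simp add: h_def norm_divide field_simps)
  qed
  have "\<exists>b. (\<forall>x\<in>submonoid S. norm (b x) \<le> M / \<delta> ^ k * size_pair x powr (- \<eta>)) \<and>
    (\<forall>s1\<in>Hplane. \<forall>s2\<in>Hplane. ((\<lambda>x. b x * dchar s1 s2 x) has_sum h k (P s1 s2)) (submonoid S))" for k
    unfolding P_def
  proof (rule compose_dirichlet_polynomial[OF S \<eta> U(1) h_hol \<open>a (1, 1) \<in> U\<close>])
    fix s1 s2 assume s: "- \<eta> < Re s1" "- \<eta> < Re s2"
    have "P s1 s2 \<in> cball (P s1 s2) \<delta>" using \<delta> by simp
    then have "P s1 s2 \<in> U" using P_cball[OF s] K'U by blast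
    then show "a (1, 1) + (\<Sum>x\<in>S. a x * dchar s1 s2 x) \<in> U" unfolding P_def .
    show "norm (h k (a (1, 1) + (\<Sum>x\<in>S. a x * dchar s1 s2 x))) \<le> M / \<delta> ^ k"
      using h_le[OF s] unfolding P_def .
  qed
  then obtain b where b_le: "\<And>k x. x \<in> submonoid S \<Longrightarrow> norm (b k x) \<le> M / \<delta> ^ k * size_pair x powr (- \<eta>)"
    and b_sum: "\<And>k s1 s2. s1 \<in> Hplane \<Longrightarrow> s2 \<in> Hplane \<Longrightarrow>
      ((\<lambda>x. b k x * dchar s1 s2 x) has_sum h k (P s1 s2)) (submonoid S)"
    by metis
  have TN: "x \<in> Npairs" if "x \<in> submonoid S" for x
    using submonoid_in_Npairs[OF _ that] S by auto
  \<comment> \<open>Powers of the tail may involve pairs outside the monoid, so the coefficients are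
    extended by 0 to \<open>Npairs\<close>, where the products are formed.\<close>
  define B where "B k x = (if x \<in> submonoid S then b k x else 0)" for k x
  \<comment> \<open>The exponent carries the factor p because the coefficient bound with decay
    \<eta> is raised to the power p.\<close>
  define W where "W x = size_pair x powr (- (\<eta> * p)) * w x" for x
  have W: "W summable_on submonoid S"
    unfolding W_def w_def using \<eta> p S by (intro summable_weight_submonoid \<omega>) auto
  define C where "C = infsum W (submonoid S)"
  have M0: "0 \<le> M"
  proof -
    have "P 0 0 \<in> cball (P 0 0) \<delta>" using \<delta> by simp
    then have "P 0 0 \<in> K'" using P_cball[of 0 0] \<eta> by auto
    then show ?thesis using M order_trans[OF norm_ge_zero] by blast
  qed
  have B_le: "norm (b k x) powr p * w x \<le> (M powr p * (1 / \<delta> powr p) ^ k) * W x"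
    if x: "x \<in> submonoid S" for k x
  proof -
    have sz: "0 < size_pair x" using size_pair_ge_1[OF TN[OF x]] by simp
    have "norm (b k x) powr p \<le> (M / \<delta> ^ k * size_pair x powr (- \<eta>)) powr p"
      using p b_le[OF x] by (intro powr_mono2) auto
    also have "\<dots> = M powr p * (1 / \<delta> powr p) ^ k * size_pair x powr (- (\<eta> * p))"
    proof -
      have "(\<delta> ^ k) powr p = (\<delta> powr p) ^ k"
        using \<delta> by (simp add: powr_realpow[symmetric] powr_powr mult.commute)
      then show ?thesis
        using M0 \<delta> by (simp add: powr_mult powr_divide powr_powr field_simps)
    qed
    finally show ?thesis
      using w0[OF TN[OF x]] unfolding W_def by (simp add: mult_right_mono flip: mult.assoc)
  qed
  have B_sm: "(\<lambda>x. norm (B k x) powr p * w x) summable_on Npairs"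
    and B_inf: "(\<Sum>\<^sub>\<infinity>x\<in>Npairs. norm (B k x) powr p * w x) \<le> M powr p * (1 / \<delta> powr p) ^ k * C" for k
  proof -
    have 1: "(\<lambda>x. norm (b k x) powr p * w x) summable_on submonoid S"
      by (rule summable_on_comparison_test[OF summable_on_cmult_right[OF W] B_le])
        (use w0 TN in auto)
    then have hs: "((\<lambda>x. norm (b k x) powr p * w x) has_sum
        (\<Sum>\<^sub>\<infinity>x\<in>submonoid S. norm (b k x) powr p * w x)) (submonoid S)" by simp
    then have hs': "((\<lambda>x. norm (B k x) powr p * w x) has_sum
        (\<Sum>\<^sub>\<infinity>x\<in>submonoid S. norm (b k x) powr p * w x)) Npairs"
      by (rule has_sum_cong_neutral[THEN iffD1, rotated 3]) (use TN in \<open>auto simp: B_def\<close>)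
    then show "(\<lambda>x. norm (B k x) powr p * w x) summable_on Npairs" by (rule has_sum_imp_summable)
    have "(\<Sum>\<^sub>\<infinity>x\<in>submonoid S. norm (b k x) powr p * w x)
        \<le> (\<Sum>\<^sub>\<infinity>x\<in>submonoid S. (M powr p * (1 / \<delta> powr p) ^ k) * W x)"
      by (intro infsum_mono 1 summable_on_cmult_right W B_le)
    then show "(\<Sum>\<^sub>\<infinity>x\<in>Npairs. norm (B k x) powr p * w x) \<le> M powr p * (1 / \<delta> powr p) ^ k * C"
      using infsumI[OF hs'] by (simp add: C_def infsum_cmult_right')
  qed
  have conv: "summable (\<lambda>k. (\<Sum>\<^sub>\<infinity>x\<in>Npairs. norm (B k x) powr p * w x) * N ^ k)"
  proof (rule summable_comparison_test')
    show "summable (\<lambda>k. M powr p * C * (N / \<delta> powr p) ^ k)"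
      using N \<delta> by (intro summable_mult summable_geometric) simp
    fix k :: nat
    have "(\<Sum>\<^sub>\<infinity>x\<in>Npairs. norm (B k x) powr p * w x) * N ^ k
        \<le> M powr p * (1 / \<delta> powr p) ^ k * C * N ^ k"
      using N by (intro mult_right_mono B_inf) auto
    moreover have "0 \<le> (\<Sum>\<^sub>\<infinity>x\<in>Npairs. norm (B k x) powr p * w x) * N ^ k"
      using N w0 by (intro mult_nonneg_nonneg infsum_nonneg) auto
    ultimately show "norm ((\<Sum>\<^sub>\<infinity>x\<in>Npairs. norm (B k x) powr p * w x) * N ^ k)
        \<le> M powr p * C * (N / \<delta> powr p) ^ k"
      by (simp add: field_simps)
  qed
  have "\<exists>v. (\<lambda>x. norm (v x) powr p * w x) summable_on Npairs \<and>
    (\<forall>\<theta> H Z R. (\<forall>x\<in>Npairs. norm (\<theta> x) powr p \<le> w x) \<longrightarrow>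
       (\<forall>x\<in>Npairs. \<forall>y\<in>Npairs. \<theta> (pmul x y) = \<theta> x * \<theta> y) \<longrightarrow>
       (\<forall>k. ((\<lambda>y. B k y * \<theta> y) has_sum H k) Npairs) \<longrightarrow>
       ((\<lambda>x. a x * \<theta> x) has_sum Z) Q \<longrightarrow> (\<lambda>k. H k * Z ^ k) sums R \<longrightarrow>
       ((\<lambda>x. v x * \<theta> x) has_sum R) Npairs)"
  proof (rule series_of_powers_expansion[OF p pmul_in_Npairs _ w_mult QN _ B_sm conv])
    show "((\<lambda>x. norm (a x) powr p * w x) has_sum N) Q" unfolding N_def using aQ by simp
    show "0 < w x" if "x \<in> Npairs" for x using w1[OF that] by simp
  qed
  then obtain v where v: "(\<lambda>x. norm (v x) powr p * w x) summable_on Npairs"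
    and v_sum: "\<And>\<theta> H Z R. \<forall>x\<in>Npairs. norm (\<theta> x) powr p \<le> w x \<Longrightarrow>
       \<forall>x\<in>Npairs. \<forall>y\<in>Npairs. \<theta> (pmul x y) = \<theta> x * \<theta> y \<Longrightarrow>
       \<forall>k. ((\<lambda>y. B k y * \<theta> y) has_sum H k) Npairs \<Longrightarrow>
       ((\<lambda>x. a x * \<theta> x) has_sum Z) Q \<Longrightarrow> (\<lambda>k. H k * Z ^ k) sums R \<Longrightarrow>
       ((\<lambda>x. v x * \<theta> x) has_sum R) Npairs"
    by blast
  have "((\<lambda>x. v x * dchar s1 s2 x) has_sum \<phi> (f s1 s2)) Npairs"
    if s: "s1 \<in> Hplane" "s2 \<in> Hplane" for s1 s2
  proof (rule v_sum)
    show "\<forall>x\<in>Npairs. norm (dchar s1 s2 x) powr p \<le> w x"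
    proof
      fix x assume x: "x \<in> Npairs"
      have "norm (dchar s1 s2 x) powr p \<le> 1 powr p"
        using p norm_dchar_le_1[OF x s] by (intro powr_mono2) auto
      then show "norm (dchar s1 s2 x) powr p \<le> w x" using w1[OF x] by simp
    qed
    show "\<forall>x\<in>Npairs. \<forall>y\<in>Npairs. dchar s1 s2 (pmul x y) = dchar s1 s2 x * dchar s1 s2 y"
      using dchar_mult by blast
    show "\<forall>k. ((\<lambda>x. B k x * dchar s1 s2 x) has_sum h k (P s1 s2)) Npairs"
    proof
      fix k
      show "((\<lambda>x. B k x * dchar s1 s2 x) has_sum h k (P s1 s2)) Npairs"
        by (rule has_sum_cong_neutral[THEN iffD1, OF _ _ _ b_sum[OF s]])
          (use TN in \<open>auto simp: B_def\<close>)
    qed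
    show "((\<lambda>x. a x * dchar s1 s2 x) has_sum f s1 s2 - P s1 s2) Q" by (rule Z_sum[OF s])
    have s': "- \<eta> < Re s1" "- \<eta> < Re s2" using s \<eta> by (auto simp: Hplane_def)
    have "f s1 s2 \<in> ball (P s1 s2) \<delta>"
      using Z_lt[OF s] by (simp add: dist_norm norm_minus_commute)
    then show "(\<lambda>k. h k (P s1 s2) * (f s1 s2 - P s1 s2) ^ k) sums \<phi> (f s1 s2)"
      unfolding h_def by (rule holomorphic_power_series[OF \<phi>_ball(1)[OF s']])
  qed
  then show ?thesis unfolding has_p_omega_DS_iff using v unfolding w_def by blast
qed

theorem theorem2:
  fixes p :: real and \<omega> :: "nat \<Rightarrow> nat \<Rightarrow> real" and f :: "complex \<Rightarrow> complex \<Rightarrow> complex"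
  assumes "0 < p" "p \<le> 1"
    and "almost_monotone_weight \<omega>"
    and "has_p_omega_DS p \<omega> f"
  shows
    "((\<exists>k>0. \<forall>s1\<in>Hplane. \<forall>s2\<in>Hplane. k \<le> norm (f s1 s2)) \<longrightarrow>
       (\<exists>\<nu>. almost_monotone_weight \<nu> \<and>
            (constant_weight \<nu> \<longleftrightarrow> constant_weight \<omega>) \<and>
            (admissible_weight \<nu> \<longleftrightarrow> admissible_weight \<omega>) \<and>
            (\<forall>m\<in>Npos. \<forall>n\<in>Npos. 1 \<le> \<nu> m n \<and> \<nu> m n \<le> \<omega> m n) \<and>
            has_p_omega_DS p \<nu> (\<lambda>s1 s2. 1 / f s1 s2)))
     \<and>
     (\<forall>\<phi> U. open U \<and> closure {f s1 s2 | s1 s2. s1 \<in> Hplane \<and> s2 \<in> Hplane} \<subseteq> U \<and>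
            \<phi> holomorphic_on U \<longrightarrow>
       (\<exists>\<xi>. almost_monotone_weight \<xi> \<and>
            (constant_weight \<xi> \<longleftrightarrow> constant_weight \<omega>) \<and>
            (admissible_weight \<xi> \<longleftrightarrow> admissible_weight \<omega>) \<and>
            (\<forall>m\<in>Npos. \<forall>n\<in>Npos. 1 \<le> \<xi> m n \<and> \<xi> m n \<le> \<omega> m n) \<and>
            has_p_omega_DS p \<xi> (\<lambda>s1 s2. \<phi> (f s1 s2))))"
proof -
  let ?range = "{f s1 s2 | s1 s2. s1 \<in> Hplane \<and> s2 \<in> Hplane}"
  have \<omega>: "is_weight \<omega>" "admissible_weight \<omega>"
    using assms(3) almost_monotone_imp_admissible by (auto simp: almost_monotone_weight_def)
  note calculus = holomorphic_calculus_dirichlet[OF assms(1,2) \<omega> assms(4)]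
  have ge1: "\<forall>m\<in>Npos. \<forall>n\<in>Npos. 1 \<le> \<omega> m n \<and> \<omega> m n \<le> \<omega> m n"
    using \<omega>(1) by (auto simp: is_weight_def)
  have inv: "has_p_omega_DS p \<omega> (\<lambda>s1 s2. 1 / f s1 s2)"
    if k: "0 < k" "\<forall>s1\<in>Hplane. \<forall>s2\<in>Hplane. k \<le> norm (f s1 s2)" for k
  proof (rule calculus[of "- {0}" "\<lambda>z. 1 / z"])
    \<comment> \<open>The values of modulus at least \<open>k\<close> form a closed set, so the
      closure of the range does not reach 0.\<close>
    have "closure ?range \<subseteq> - ball 0 k"
      by (rule closure_minimal) (use k in \<open>force simp: closed_Compl\<close>)+
    then show "closure ?range \<subseteq> - {0}" using k(1) by auto
  qed (auto intro!: holomorphic_intros)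
  show ?thesis
    using inv calculus assms(3) ge1 by (intro conjI impI allI exI[of _ \<omega>]) blast+
qed

end
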